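(* Let $\Omega$, $\Gamma_1,\dots,\Gamma_n$ ($n\ge2$), $\lambda=2A/P$ and $\varphi$ be as in the standing setup, with $\varphi$ satisfying relation (E). Then for every $k$ and every $z\in\Gamma_k$, $$\varphi'(z)\,\tau_k(z)^2 = 1+\alpha_k\lambda\kappa_k(z),$$ i.e. $\varphi'(z)\,dz^2=(1+\alpha_k\lambda\kappa_k)\,ds^2$ along $\Gamma_k$; in particular $\varphi'(z)\,dz^2$ is real-valued on $\partial\Omega$. Moreover, for every $k=1,\dots,n$, $$\oint_{\Gamma_k}(1+\alpha_k\lambda\kappa_k)\,ds>0.$$
   Context: Standing setup: $\Omega\subset\mathbb{C}$ is a bounded domain whose boundary consists of $n\ge 2$ pairwise disjoint real-analytic simple closed curves; $\Gamma_1$ is the one bounding the unbounded component of $\mathbb{C}\setminus\overline{\Omega}$, and $\Gamma_2,\dots,\Gamma_n$ are the inner components. $A$ is the area of $\Omega$, $L_k$ the length of $\Gamma_k$, $P=\sum_k L_k$, $\lambda=2A/P$. For $z\in\Gamma_k$, $\tau_k(z)$ is the unit tangent (as a complex number) for the counterclockwise orientation of $\Gamma_k$, $s$ is arclength in that orientation, and $\kappa_k=-i\,\overline{\tau_k}\,\frac{d\tau_k}{ds}$ is the (signed) curvature, so a counterclockwise circle of radius $R$ has $\kappa=1/R$. $\alpha_1=-1$ and $\alpha_k=1$ for $k\ge2$. $\varphi$ is holomorphic in $\Omega$, continuously differentiable up to $\partial\Omega$, and satisfies (E): $\bar z + i\alpha_k\lambda\,\overline{\tau_k(z)}=\varphi(z)$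 for all $z\in\Gamma_k$, $k=1,\dots,n$. *)

theory Defs
  imports "HOL-Analysis.Analysis"
begin

definition real_analytic_curve :: "(real \<Rightarrow> complex) \<Rightarrow> bool" where
  "real_analytic_curve \<gamma> \<longleftrightarrow>
     (\<forall>s0. \<exists>r>0. \<exists>c :: nat \<Rightarrow> complex.
        \<forall>s. \<bar>s - s0\<bar> < r \<longrightarrow> (\<lambda>m. c m * of_real ((s - s0) ^ m)) sums \<gamma> s)"

definition tangent :: "(real \<Rightarrow> complex) \<Rightarrow> real \<Rightarrow> complex" where
  "tangent \<gamma> s = vector_derivative \<gamma> (at s)"

text \<open>Signed curvature kappa = -i conj(tau) dtau/ds (a real number for unit-speed curves).\<close>
definition curvature :: "(real \<Rightarrow> complex) \<Rightarrow> real \<Rightarrow> real" where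
  "curvature \<gamma> s = Re (- \<i> * cnj (tangent \<gamma> s) * vector_derivative (tangent \<gamma>) (at s))"

definition arclength_analytic_jordan :: "(real \<Rightarrow> complex) \<Rightarrow> real \<Rightarrow> bool" where
  "arclength_analytic_jordan \<gamma> L \<longleftrightarrow>
     L > 0 \<and> (\<forall>s. \<gamma> (s + L) = \<gamma> s) \<and> inj_on \<gamma> {0..<L} \<and>
     real_analytic_curve \<gamma> \<and> (\<forall>s. norm (tangent \<gamma> s) = 1)"

definition counterclockwise :: "(real \<Rightarrow> complex) \<Rightarrow> real \<Rightarrow> bool" where
  "counterclockwise \<gamma> L \<longleftrightarrow>
     (\<forall>w \<in> inside (\<gamma> ` {0..L}).
        ((\<lambda>s. tangent \<gamma> s / (\<gamma> s - w)) has_integral (2 * pi * \<i>)) {0..L})"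

definition alpha :: "nat \<Rightarrow> real" where
  "alpha k = (if k = 1 then -1 else 1)"

end

theory Submission
  imports Defs "HOL-Complex_Analysis.Complex_Analysis"
begin

text \<open>The boundary formula is the derivative of (E) along \<open>\<Gamma>\<^sub>k\<close>: since \<open>\<Omega>\<close> contains one side of each boundary
  curve near every boundary point, \<open>\<phi> \<circ> \<gamma>\<^sub>k\<close> can be differentiated by pushing the curve into \<open>\<Omega>\<close>, and
  \<open>d\<tau>/ds = i \<kappa> \<tau>\<close> does the rest.

  For the sign of the integral, Hopf's Umlaufsatz gives \<open>\<integral> \<kappa> ds = 2\<pi>\<close>, so the integral over \<open>\<Gamma>\<^sub>k\<close> is
  \<open>L\<^sub>k + 2\<pi> \<alpha>\<^sub>k \<lambda>\<close>. This is clearly positive for \<open>k \<ge> 2\<close>; for \<open>k = 1\<close> it means \<open>4\<pi> A < L\<^sub>1 P\<close>, which follows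
  from the isoperimetric inequality \<open>4\<pi> A \<le> L\<^sub>1\<^sup>2\<close> and \<open>L\<^sub>1 < P\<close>. The isoperimetric inequality is obtained by
  integrating \<open>2\<pi> i = \<integral> d\<zeta> / (\<zeta> - w)\<close> over \<open>w \<in> \<Omega>\<close> and exchanging integrals: the area integral of
  \<open>Im (\<tau> / (\<zeta> - w))\<close> is at most \<open>\<surd>(\<pi> A)\<close> by the Ahlfors--Beurling estimate.\<close>

section \<open>Increments of logarithms and the turning number of a simple closed curve\<close>

text \<open>Two continuous logarithms of one function differ by a continuous function with values in
  the integer multiples of \<open>2 * pi * \<i>\<close>. These values lie at least
  \<open>2 * pi\<close> apart, so the difference is constant on a connected set.\<close>

lemma log_increment_unique:
  fixes f g :: "'a::topological_space \<Rightarrow> complex"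
  assumes "connected S" "continuous_on S f" "continuous_on S g"
    and eq: "\<And>x. x \<in> S \<Longrightarrow> exp (f x) = exp (g x)" and "x \<in> S" "y \<in> S"
  shows "f y - f x = g y - g x"
proof -
  have "(\<lambda>x. f x - g x) constant_on S"
  proof (rule continuous_discrete_range_constant[OF \<open>connected S\<close>])
    show "continuous_on S (\<lambda>x. f x - g x)"
      by (intro continuous_intros assms)
    fix a assume a: "a \<in> S"
    have "2 * pi \<le> norm ((f b - g b) - (f a - g a))"
      if b: "b \<in> S" and neq: "f b - g b \<noteq> f a - g a" for b
    proof -
      obtain m :: int where m: "f a = g a + (of_int (2 * m) * pi) * \<i>"
        using eq[OF a] unfolding exp_eq by blast
      obtain k :: int where k: "f b = g b + (of_int (2 * k) * pi) * \<i>"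
        using eq[OF b] unfolding exp_eq by blast
      note mk = m k
      have "(f b - g b) - (f a - g a) = of_real (2 * pi * of_int (k - m)) * \<i>"
        using mk by (simp add: algebra_simps)
      then have "norm ((f b - g b) - (f a - g a)) = \<bar>2 * pi * of_int (k - m)\<bar>"
        by (simp only: norm_mult norm_of_real norm_ii mult_1_right)
      also have "\<dots> = 2 * pi * \<bar>of_int (k - m)\<bar>"
        by (simp add: abs_mult)
      also have "\<dots> \<ge> 2 * pi * 1"
        using neq mk by (intro mult_left_mono) auto
      finally show ?thesis by simp
    qed
    then show "\<exists>e>0. \<forall>b. b \<in> S \<and> f b - g b \<noteq> f a - g a \<longrightarrow> e \<le> norm ((f b - g b) - (f a - g a))"
      by (intro exI[of _ "2 * pi"]) auto
  qed
  then obtain c where "\<And>x. x \<in> S \<Longrightarrow> f x - g x = c"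
    unfolding constant_on_def by blast
  then have "f x - g x = f y - g y"
    using assms by simp
  then show ?thesis by (simp add: algebra_simps)
qed

text \<open>For an antiderivative \<open>Q\<close> of \<open>f' / f\<close> the product
  \<open>f t * exp (- Q t)\<close> has derivative zero. Hence \<open>Q\<close> plus a constant is a
  logarithm of \<open>f\<close>, and its increment agrees with that of \<open>G\<close>.\<close>

lemma has_integral_log_derivative:
  fixes f f' G :: "real \<Rightarrow> complex"
  assumes "a \<le> b" and cont: "continuous_on {a..b} f'"
    and f: "\<And>t. t \<in> {a..b} \<Longrightarrow> (f has_vector_derivative f' t) (at t within {a..b})"
    and G: "continuous_on {a..b} G" "\<And>t. t \<in> {a..b} \<Longrightarrow> exp (G t) = f t"
  shows "((\<lambda>t. f' t / f t) has_integral (G b - G a)) {a..b}"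
proof -
  have nz: "f t \<noteq> 0" if "t \<in> {a..b}" for t
    using G(2)[OF that] by (metis exp_not_eq_zero)
  have contf: "continuous_on {a..b} f"
    by (auto simp: continuous_on_eq_continuous_within intro: has_vector_derivative_continuous[OF f])
  have "continuous_on {a..b} (\<lambda>t. f' t / f t)"
    by (intro continuous_intros cont contf) (use nz in auto)
  then obtain Q where Q: "\<And>t. t \<in> {a..b} \<Longrightarrow> (Q has_vector_derivative (f' t / f t)) (at t within {a..b})"
    using antiderivative_continuous by blast
  have contQ: "continuous_on {a..b} Q"
    by (auto simp: continuous_on_eq_continuous_within intro: has_vector_derivative_continuous[OF Q])
  have "((\<lambda>t. f t * exp (- Q t)) has_vector_derivative 0) (at t within {a..b})" if t: "t \<in> {a..b}" for t
  proof -
    have "((\<lambda>t. exp (- Q t)) has_vector_derivative (- (f' t / f t) * exp (- Q t))) (at t within {a..b})"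
      using field_vector_diff_chain_within[where g = exp, OF has_vector_derivative_minus[OF Q[OF t]],
          OF DERIV_subset[OF DERIV_exp subset_UNIV]]
      by (simp add: o_def)
    from has_vector_derivative_mult[OF f[OF t] this] show ?thesis
      using nz[OF t] by simp
  qed
  then obtain c where c: "\<And>t. t \<in> {a..b} \<Longrightarrow> f t * exp (- Q t) = c"
    using has_vector_derivative_zero_constant[of "{a..b}" "\<lambda>t. f t * exp (- Q t)"] by auto
  have "c \<noteq> 0"
    using c[of a] nz[of a] \<open>a \<le> b\<close> by auto
  have "exp (Ln c + Q t) = exp (G t)" if "t \<in> {a..b}" for t
    using c[OF that] \<open>c \<noteq> 0\<close> G(2)[OF that] by (auto simp: exp_add exp_minus field_simps)
  then have "(Ln c + Q b) - (Ln c + Q a) = G b - G a"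
    using \<open>a \<le> b\<close> by (intro log_increment_unique[of "{a..b}"] continuous_intros contQ G) auto
  moreover have "((\<lambda>t. f' t / f t) has_integral (Q b - Q a)) {a..b}"
    by (rule fundamental_theorem_of_calculus[OF \<open>a \<le> b\<close> Q])
  ultimately show ?thesis by simp
qed

text \<open>The difference quotient \<open>(\<gamma> t - \<gamma> s) / (t - s)\<close> of an antiderivative \<open>\<gamma>\<close> of \<open>\<tau>\<close>, in a form that is
  visibly continuous across the diagonal.\<close>

definition secant :: "(real \<Rightarrow> complex) \<Rightarrow> real \<Rightarrow> real \<Rightarrow> complex" where
  "secant \<tau> s t = integral {0..1} (\<lambda>u. \<tau> (s + u * (t - s)))"

lemma secant_same [simp]: "secant \<tau> s s = \<tau> s"
  by (simp add: secant_def)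

lemma continuous_on_secant:
  assumes "continuous_on UNIV \<tau>"
  shows "continuous_on UNIV (\<lambda>p. secant \<tau> (fst p) (snd p))"
proof -
  have "continuous_on (UNIV \<times> cbox 0 1) (\<lambda>(p, u). \<tau> (fst p + u * (snd p - fst p)))"
    unfolding case_prod_unfold
    by (rule continuous_on_compose2[OF assms]) (auto intro!: continuous_intros)
  then have "continuous_on UNIV (\<lambda>p. integral (cbox 0 1) (\<lambda>u. \<tau> (fst p + u * (snd p - fst p))))"
    by (rule integral_continuous_on_param)
  then show ?thesis by (simp add: secant_def)
qed

lemma secant_mult:
  assumes \<tau>: "continuous_on UNIV \<tau>" and \<gamma>: "\<And>s. (\<gamma> has_vector_derivative \<tau> s) (at s)"
  shows "of_real (t - s) * secant \<tau> s t = \<gamma> t - \<gamma> s"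
proof -
  have "((\<lambda>u. \<gamma> (s + u * (t - s))) has_vector_derivative of_real (t - s) * \<tau> (s + u * (t - s))) (at u within {0..1})" for u
  proof -
    have "((\<lambda>u. s + u * (t - s)) has_vector_derivative (t - s)) (at u within {0..1})"
      by (auto intro!: derivative_eq_intros simp: has_real_derivative_iff_has_vector_derivative[symmetric])
    from vector_diff_chain_within[OF this, of \<gamma>] \<gamma>[THEN has_vector_derivative_at_within]
    show ?thesis by (simp add: o_def scaleR_conv_of_real)
  qed
  then have "((\<lambda>u. of_real (t - s) * \<tau> (s + u * (t - s))) has_integral (\<gamma> (s + 1 * (t - s)) - \<gamma> (s + 0 * (t - s)))) {0..1}"
    by (intro fundamental_theorem_of_calculus) auto
  from integral_unique[OF this] show ?thesis
    by (simp add: secant_def)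
qed

section \<open>Regular simple closed curves and their secant slopes\<close>

locale simple_closed_curve =
  fixes \<gamma> \<tau> :: "real \<Rightarrow> complex" and L :: real
  assumes L_pos: "L > 0" and periodic: "\<gamma> (s + L) = \<gamma> s" and inj: "inj_on \<gamma> {0..<L}"
    and deriv: "(\<gamma> has_vector_derivative \<tau> s) (at s)"
    and cont_deriv: "continuous_on UNIV \<tau>" and deriv_nonzero: "\<tau> s \<noteq> 0"
begin

lemma continuous: "continuous_on S \<gamma>"
  by (intro continuous_at_imp_continuous_on ballI has_vector_derivative_continuous[OF deriv])

lemma periodic_of_int: "\<gamma> (s + of_int m * L) = \<gamma> s"
proof -
  have *: "\<gamma> (s + of_nat k * L) = \<gamma> s" for k s
  proof (induction k)
    case (Suc k)
    then show ?case using periodic[of "s + of_nat k * L"] by (simp add: algebra_simps)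
  qed simp
  show ?thesis
  proof (cases m rule: int_cases2)
    case (nonneg n)
    then show ?thesis using * by simp
  next
    case (nonpos n)
    then show ?thesis using *[of "s - of_nat n * L" n] by simp
  qed
qed

lemma reduce_mod_period:
  obtains m :: int where "a \<le> s + of_int m * L" "s + of_int m * L < a + L"
proof
  define m where "m = - \<lfloor>(s - a) / L\<rfloor>"
  have "of_int \<lfloor>(s - a) / L\<rfloor> * L \<le> s - a" "s - a < (of_int \<lfloor>(s - a) / L\<rfloor> + 1) * L"
    using floor_correct[of "(s - a) / L"] L_pos
    by (auto simp: pos_le_divide_eq[symmetric] pos_divide_less_eq[symmetric])
  then show "a \<le> s + of_int m * L" "s + of_int m * L < a + L"
    by (simp_all add: m_def algebra_simps)
qed

lemma range_eq: "range \<gamma> = \<gamma> ` {a..a + L}"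
proof -
  have "\<gamma> s \<in> \<gamma> ` {a..a + L}" for s
  proof -
    obtain m :: int where "a \<le> s + of_int m * L" "s + of_int m * L < a + L"
      by (rule reduce_mod_period)
    then show ?thesis using periodic_of_int[of s m] by (metis atLeastAtMost_iff imageI less_imp_le)
  qed
  then show ?thesis by auto
qed

lemma eq_imp_period:
  assumes "\<gamma> s = \<gamma> t" obtains m :: int where "t = s + of_int m * L"
proof -
  obtain i :: int where i: "0 \<le> s + of_int i * L" "s + of_int i * L < 0 + L"
    by (rule reduce_mod_period)
  obtain j :: int where j: "0 \<le> t + of_int j * L" "t + of_int j * L < 0 + L"
    by (rule reduce_mod_period)
  have "s + of_int i * L = t + of_int j * L"
    using i j assms periodic_of_int by (intro inj_onD[OF inj]) auto
  then have "t = s + of_int (i - j) * L" by (simp add: algebra_simps)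
  then show ?thesis by (rule that)
qed

lemma eq_imp_eq:
  assumes "\<gamma> s = \<gamma> t" "\<bar>t - s\<bar> < L" shows "s = t"
proof -
  obtain m :: int where m: "t = s + of_int m * L"
    using eq_imp_period[OF assms(1)] .
  then have "\<bar>of_int m\<bar> * L < 1 * L"
    using assms(2) L_pos by (simp add: abs_mult)
  then have "\<bar>of_int m :: real\<bar> < 1"
    using L_pos by (subst (asm) mult_less_cancel_right_pos)
  then have "m = 0" by linarith
  then show ?thesis using m by simp
qed

lemma periodic_deriv: "\<tau> (s + L) = \<tau> s"
proof -
  have "((\<lambda>s. \<gamma> (s + L)) has_vector_derivative \<tau> (s + L)) (at s)"
    using vector_diff_chain_at[of "\<lambda>s. s + L" 1 s \<gamma> "\<tau> (s + L)"] deriv[of "s + L"]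
      has_vector_derivative_id[of "at s"]
    by (simp add: o_def has_vector_derivative_add_const)
  then show ?thesis
    using deriv[of s] vector_derivative_unique_at by (simp add: periodic)
qed

lemma secant_mult': "of_real (t - s) * secant \<tau> s t = \<gamma> t - \<gamma> s"
  by (rule secant_mult[OF cont_deriv deriv])

lemma secant_commute: "secant \<tau> s t = secant \<tau> t s"
proof (cases "s = t")
  case False
  have "of_real (t - s) * secant \<tau> s t = of_real (t - s) * secant \<tau> t s"
    using secant_mult'[of t s] secant_mult'[of s t] minus_mult_left[of "of_real (s - t)" "secant \<tau> t s"]
    by simp
  then show ?thesis using False by (simp del: of_real_diff)
qed simp

lemma secant_shift: "secant \<tau> (s + L) (t + L) = secant \<tau> s t"
proof -
  have "s + L + u * (t + L - (s + L)) = (s + u * (t - s)) + L" for u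
    by simp
  then show ?thesis unfolding secant_def by (simp only: periodic_deriv)
qed

text \<open>Off the diagonal a zero would be a self-intersection within less than one period; on it
  the slope is the nonvanishing derivative. The bound is sharp, since the slope vanishes when
  \<open>\<bar>t - s\<bar> = L\<close>.\<close>

lemma secant_nonzero:
  assumes "\<bar>t - s\<bar> < L" shows "secant \<tau> s t \<noteq> 0"
proof (cases "s = t")
  case False
  then show ?thesis using secant_mult'[of t s] eq_imp_eq[of s t] assms by auto
qed (simp add: deriv_nonzero)

lemma continuous_on_secant_right: "continuous_on S (\<lambda>t. secant \<tau> s t)"
proof -
  have "continuous_on S (\<lambda>t. (s, t))"
    by (intro continuous_intros)
  from continuous_on_compose2[OF continuous_on_secant[OF cont_deriv] this] show ?thesis by simp
qed


section \<open>Increments of \<open>log (\<gamma> - w)\<close> over one period\<close>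

lemma periodic_log_increment:
  assumes G: "continuous_on UNIV G" "\<And>t. exp (G t) = \<gamma> t - w"
  shows "G (a + L) - G a = G L - G 0"
proof -
  have "continuous_on UNIV (\<lambda>t. G (t + L))"
    by (rule continuous_on_compose2[OF G(1)]) (auto intro!: continuous_intros)
  then have "G (a + L) - G (0 + L) = G a - G 0"
    by (intro log_increment_unique[of UNIV "\<lambda>t. G (t + L)" G 0 a]) (auto simp: G periodic)
  then show ?thesis by (simp add: algebra_simps)
qed

text \<open>After rescaling the period to the unit interval, the increment is
  \<open>2 * pi * \<i>\<close> times a winding number, which is zero for points outside the
  curve.\<close>

lemma log_increment_outside:
  assumes w: "w \<in> outside (range \<gamma>)" and G: "continuous_on UNIV G" "\<And>t. exp (G t) = \<gamma> t - w"
  shows "G L = G 0"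
proof -
  define p where "p x = \<gamma> (L * x)" for x
  have p: "path p"
    unfolding path_def p_def by (rule continuous_on_compose2[OF continuous]) (auto intro!: continuous_intros)
  have "path_image p = \<gamma> ` ((\<lambda>x. L * x) ` {0..1})"
    by (auto simp: path_image_def p_def)
  also have "(\<lambda>x. L * x) ` {0..1} = {0..L}"
    using L_pos by (simp add: image_mult_atLeastAtMost)
  finally have im: "path_image p = range \<gamma>"
    using range_eq[of 0] by simp
  have loop: "pathfinish p = pathstart p"
    using periodic[of 0] by (simp add: p_def pathfinish_def pathstart_def)
  have "w \<notin> path_image p"
    using w im outside_no_overlap by blast
  then obtain q where q: "path q" "pathfinish q - pathstart q = 2 * of_real pi * \<i> * winding_number p w"
      "\<And>t. t \<in> {0..1} \<Longrightarrow> p t = w + exp (q t)"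
    by (rule winding_number_as_continuous_log[OF p]) blast
  have "continuous_on {0..1} (\<lambda>x. G (L * x))"
    by (rule continuous_on_compose2[OF G(1)]) (auto intro!: continuous_intros)
  moreover have "exp (G (L * x)) = exp (q x)" if "x \<in> {0..1}" for x
    using q(3)[OF that] by (simp add: G p_def)
  ultimately have "G (L * 1) - G (L * 0) = q 1 - q 0"
    using q(1) unfolding path_def by (intro log_increment_unique[of "{0..1}"]) auto
  also have "\<dots> = 0"
    using q(2) winding_number_zero_in_outside[OF p loop] w im by (simp add: pathfinish_def pathstart_def)
  finally show ?thesis by simp
qed

lemma log_increment_inside:
  assumes winding: "((\<lambda>s. \<tau> s / (\<gamma> s - w)) has_integral (2 * pi * \<i>)) {0..L}"
    and G: "continuous_on UNIV G" "\<And>t. exp (G t) = \<gamma> t - w"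
  shows "G L - G 0 = 2 * pi * \<i>"
proof -
  have "((\<lambda>s. \<tau> s / (\<gamma> s - w)) has_integral (G L - G 0)) {0..L}"
  proof (rule has_integral_log_derivative)
    show "((\<lambda>s. \<gamma> s - w) has_vector_derivative \<tau> t) (at t within {0..L})" for t
      by (auto intro!: derivative_eq_intros has_vector_derivative_at_within[OF deriv])
  qed (use L_pos G continuous_on_subset[OF G(1)] continuous_on_subset[OF cont_deriv] in auto)
  then show ?thesis using winding has_integral_unique by blast
qed

end

lemma continuous_log_real:
  fixes f :: "real \<Rightarrow> complex"
  assumes "continuous_on UNIV f" "\<And>t. f t \<noteq> 0"
  shows "\<exists>G. continuous_on UNIV G \<and> (\<forall>t. exp (G t) = f t)"
proof (rule continuous_logarithm_on_contractible[OF assms(1)])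
  show "contractible (UNIV :: real set)"
    by (simp add: convex_imp_contractible)
next
  fix G assume "continuous_on UNIV G" "\<And>x. x \<in> UNIV \<Longrightarrow> f x = exp (G x)"
  then show ?thesis by (intro exI[of _ G]) simp
qed (rule assms(2))

section \<open>Hopf's theorem on the turning number\<close>

context simple_closed_curve begin

text \<open>The secant slopes from \<open>\<gamma> a\<close> are compared with \<open>(\<gamma> t - w) / (t - a - \<i>\<sigma>e)\<close>, where \<open>w = \<gamma> a + \<i>\<sigma>e \<tau> a\<close>: the
  two are close enough to have logarithmic increments that differ by less than \<open>\<pi>\<close>, and the numerator
  contributes the winding number of \<open>\<gamma>\<close> about \<open>w\<close>.\<close>

lemma Im_secant_half_turn_bounds:
  assumes \<sigma>: "\<sigma> = 1 \<or> \<sigma> = -1"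
    and log01: "\<And>w G. \<lbrakk>w \<notin> range \<gamma>; continuous_on UNIV G; \<And>t. exp (G t) = \<gamma> t - w\<rbrakk>
      \<Longrightarrow> G L - G 0 = 0 \<or> G L - G 0 = 2 * pi * \<i>"
    and g: "continuous_on {a - L/2..a + L/2} g" "\<And>t. t \<in> {a - L/2..a + L/2} \<Longrightarrow> exp (g t) = secant \<tau> a t"
  shows "\<exists>x y. \<sigma> * x \<in> {0<..<pi} \<and> \<bar>y\<bar> < pi \<and>
    (Im (g (a + L/2) - g (a - L/2)) = - x - y \<or> Im (g (a + L/2) - g (a - L/2)) = 2 * pi - x - y)"
proof -
  let ?I = "{a - L/2..a + L/2}"
  define D where "D t = secant \<tau> a t" for t
  have I: "compact ?I" "?I \<noteq> {}" "a \<in> ?I" using L_pos by auto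
  have contD: "continuous_on S D" for S
    unfolding D_def by (rule continuous_on_secant_right)
  have D_nz: "D t \<noteq> 0" if "t \<in> ?I" for t
    unfolding D_def using that L_pos by (intro secant_nonzero) (auto simp: abs_if field_simps)
  have D_mult: "of_real (t - a) * D t = \<gamma> t - \<gamma> a" for t
    unfolding D_def by (rule secant_mult')
  have "continuous_on ?I (\<lambda>t. norm (D t))"
    by (intro continuous_intros contD)
  then obtain t0 where t0: "t0 \<in> ?I" "\<And>t. t \<in> ?I \<Longrightarrow> norm (D t0) \<le> norm (D t)"
    using continuous_attains_inf[OF I(1,2)] by blast
  define m where "m = norm (D t0)"
  have m: "m > 0" "\<And>t. t \<in> ?I \<Longrightarrow> m \<le> norm (D t)"
    using t0 D_nz by (auto simp: m_def)
  have "continuous_on ?I (\<lambda>t. norm (D t - \<tau> a))"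
    by (intro continuous_intros contD)
  then obtain t1 where t1: "\<And>t. t \<in> ?I \<Longrightarrow> norm (D t - \<tau> a) \<le> norm (D t1 - \<tau> a)"
    using continuous_attains_sup[OF I(1,2)] by blast
  \<comment> \<open>The summand 1 keeps \<open>K\<close> positive, because \<open>e\<close> below is
    a quotient by \<open>K\<close>.\<close>
  define K where "K = norm (D t1 - \<tau> a) + 1"
  have K: "K > 0" "\<And>t. t \<in> ?I \<Longrightarrow> norm (D t - \<tau> a) \<le> K"
    using t1 by (auto simp: K_def add_pos_nonneg add.commute intro: add_increasing)
  have "\<tau> a = D a" by (simp add: D_def)
  then obtain \<delta> where \<delta>: "\<delta> > 0" "\<And>t. \<bar>t - a\<bar> < \<delta> \<Longrightarrow> norm (D t - \<tau> a) < m"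
    using contD[of UNIV] m(1) unfolding continuous_on_iff dist_norm real_norm_def
    by (metis UNIV_I)
  \<comment> \<open>The displacement is small enough in two regimes. Within distance
    \<open>\<delta>\<close> of \<open>a\<close>, \<open>D\<close> is closer than \<open>m\<close> to
    \<open>\<tau> a\<close> and \<open>e \<le> norm (d t)\<close>. Further away only the bound
    \<open>K\<close> is available, but \<open>norm (d t) \<ge> \<delta>\<close> and
    \<open>e * K < \<delta> * m\<close>.\<close>
  define e where "e = \<delta> * m / (2 * K)"
  have e: "e > 0" "e * K < \<delta> * m"
    using \<delta> m K by (auto simp: e_def field_simps)
  define d where "d t = of_real (t - a) - \<i> * of_real (\<sigma> * e)" for t :: real
  define w where "w = \<gamma> a + \<i> * of_real (\<sigma> * e) * \<tau> a"
  have d_ge: "norm (d t) \<ge> \<bar>t - a\<bar>" "norm (d t) \<ge> e" for t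
    using abs_Re_le_cmod[of "d t"] abs_Im_le_cmod[of "d t"] \<sigma> e by (auto simp: d_def)
  have contd: "continuous_on ?I d"
    unfolding d_def by (intro continuous_intros)
  have d_nz: "d t \<noteq> 0" for t
    using d_ge(2)[of t] e by auto
  have diff: "(\<gamma> t - w) / d t - D t = \<i> * of_real (\<sigma> * e) * (D t - \<tau> a) / d t" for t
    using D_mult[of t] d_nz[of t] by (simp add: w_def d_def field_simps)
  have close: "norm ((\<gamma> t - w) / d t - D t) < m" if t: "t \<in> ?I" for t
  proof -
    have "norm ((\<gamma> t - w) / d t - D t) = e * norm (D t - \<tau> a) / norm (d t)"
      unfolding diff using \<sigma> e by (auto simp: norm_mult norm_divide)
    also have "\<dots> < m"
    proof (cases "\<bar>t - a\<bar> < \<delta>")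
      case True
      have "e * norm (D t - \<tau> a) \<le> norm (d t) * norm (D t - \<tau> a)"
        using d_ge[of t] by (intro mult_right_mono) auto
      also have "\<dots> < norm (d t) * m"
        using \<delta>(2)[OF True] d_nz[of t] by simp
      finally show ?thesis using d_nz[of t] by (simp add: pos_divide_less_eq mult.commute)
    next
      case False
      have "e * norm (D t - \<tau> a) \<le> e * K"
        using K(2)[OF t] e by (intro mult_left_mono) auto
      also have "\<dots> < \<delta> * m" by (rule e)
      also have "\<dots> \<le> norm (d t) * m"
        using False d_ge[of t] m by (intro mult_right_mono) auto
      finally show ?thesis using d_nz[of t] by (simp add: pos_divide_less_eq mult.commute)
    qed
    finally show ?thesis .
  qed
  \<comment> \<open>This is the quotient of the two functions being compared. Being closer than 1 to
    the point 1, it stays in the right half-plane, where the principal logarithm is continuous with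
    imaginary part below \<open>pi / 2\<close> in modulus. The two endpoints then contribute less
    than \<open>pi\<close>.\<close>
  define N where "N t = (\<gamma> t - w) / d t / D t" for t
  have N1: "norm (N t - 1) < 1" if t: "t \<in> ?I" for t
  proof -
    have "N t - 1 = ((\<gamma> t - w) / d t - D t) / D t"
      using D_nz[OF t] by (simp add: N_def field_simps)
    then have "norm (N t - 1) = norm ((\<gamma> t - w) / d t - D t) / norm (D t)"
      by (simp add: norm_divide)
    also have "\<dots> < 1"
      using close[OF t] m(2)[OF t] D_nz[OF t] by (subst divide_less_eq_1_pos) auto
    finally show ?thesis .
  qed
  have ReN: "Re (N t) > 0" if t: "t \<in> ?I" for t
    using N1[OF t] abs_Re_le_cmod[of "N t - 1"] by (simp; linarith)
  have off: "\<gamma> t \<noteq> w" if "t \<in> ?I" for t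
    using ReN[OF that] by (auto simp: N_def)
  have "range \<gamma> = \<gamma> ` ?I"
    using range_eq[of "a - L/2"] by (simp add: add.commute)
  then have w: "w \<notin> range \<gamma>"
    by (metis imageE off)
  have cont_w: "continuous_on UNIV (\<lambda>t. \<gamma> t - w)"
    by (intro continuous_intros continuous)
  obtain G where G: "continuous_on UNIV G" "\<And>t. exp (G t) = \<gamma> t - w"
    using continuous_log_real[OF cont_w] w by auto
  \<comment> \<open>The values of \<open>d\<close> run along a horizontal line. Multiplication by
    \<open>\<i> * \<sigma>\<close> turns it into the vertical line with real part
    \<open>e > 0\<close>, away from the branch cut; the subtracted constant undoes the
    rotation.\<close>
  define lnd where "lnd t = Ln (\<i> * of_real \<sigma> * d t) - \<i> * of_real (\<sigma> * pi / 2)" for t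
  have rot: "\<i> * of_real \<sigma> * d t = of_real e + \<i> * of_real (\<sigma> * (t - a))" for t
    using \<sigma> by (auto simp: d_def complex_eq_iff)
  have exp_lnd: "exp (lnd t) = d t" for t
  proof -
    have "exp (\<i> * of_real (\<sigma> * pi / 2)) = \<i> * of_real \<sigma>"
      using \<sigma> by (auto simp: exp_eq_polar cis_conv_exp[symmetric] complex_eq_iff)
    moreover have "\<i> * of_real \<sigma> * d t \<noteq> 0"
      using \<sigma> d_nz by auto
    ultimately show ?thesis
      using \<sigma> by (auto simp: lnd_def exp_diff)
  qed
  have contlnd: "continuous_on ?I lnd"
    unfolding lnd_def rot
    by (intro continuous_intros) (use e in \<open>auto simp: complex_nonpos_Reals_iff\<close>)
  have "continuous_on ?I N"
    unfolding N_def using D_nz d_nz by (intro continuous_intros contD continuous contd) auto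
  then have contN: "continuous_on ?I (\<lambda>t. Ln (N t))"
    using ReN by (intro continuous_on_Ln') (force simp: complex_nonpos_Reals_iff)+
  \<comment> \<open>Since \<open>D t * N t * d t = \<gamma> t - w\<close>, the three logarithms add
    up to one of \<open>\<gamma> - w\<close>, whose increment over a period is known.\<close>
  have "(g (a + L/2) + Ln (N (a + L/2)) + lnd (a + L/2)) - (g (a - L/2) + Ln (N (a - L/2)) + lnd (a - L/2))
      = G (a + L/2) - G (a - L/2)"
  proof (rule log_increment_unique[of ?I])
    show "continuous_on ?I (\<lambda>t. g t + Ln (N t) + lnd t)"
      by (intro continuous_intros g contN contlnd)
    fix t assume t: "t \<in> ?I"
    have "N t \<noteq> 0"
      using ReN[OF t] by auto
    then have "exp (g t + Ln (N t) + lnd t) = D t * N t * d t"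
      by (simp add: exp_add exp_lnd g(2)[OF t] D_def)
    also have "\<dots> = exp (G t)"
      using D_nz[OF t] d_nz[of t] by (simp add: N_def G(2))
    finally show "exp (g t + Ln (N t) + lnd t) = exp (G t)" .
  qed (use L_pos in \<open>auto intro: continuous_on_subset[OF G(1)]\<close>)
  moreover have "G (a + L/2) - G (a - L/2) = G L - G 0"
    using periodic_log_increment[OF G, of "a - L/2"] by (simp add: add.commute)
  ultimately have eq: "g (a + L/2) - g (a - L/2)
      = (G L - G 0) - (lnd (a + L/2) - lnd (a - L/2)) - (Ln (N (a + L/2)) - Ln (N (a - L/2)))"
    by (simp add: algebra_simps)
  define u where "u = Im (Ln (of_real e + \<i> * of_real (\<sigma> * (L/2))))"
  define v where "v = Im (Ln (of_real e - \<i> * of_real (\<sigma> * (L/2))))"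
  define y where "y = Im (Ln (N (a + L/2))) - Im (Ln (N (a - L/2)))"
  have "\<i> * of_real \<sigma> * d (a + L/2) = of_real e + \<i> * of_real (\<sigma> * (L/2))"
    "\<i> * of_real \<sigma> * d (a - L/2) = of_real e - \<i> * of_real (\<sigma> * (L/2))"
    unfolding rot by auto
  then have "Im (lnd (a + L/2) - lnd (a - L/2)) = u - v"
    unfolding lnd_def by (simp only: u_def v_def) simp
  then have "Im (g (a + L/2) - g (a - L/2)) = Im (G L - G 0) - (u - v) - y"
    unfolding eq by (simp add: y_def)
  moreover have "\<bar>y\<bar> < pi"
  proof -
    have "\<bar>Im (Ln (N t))\<bar> < pi / 2" if "t \<in> ?I" for t
      by (rule Re_Ln_pos_lt_imp[OF ReN[OF that]])
    from this[of "a + L/2"] this[of "a - L/2"] show ?thesis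
      using L_pos unfolding y_def by (simp; linarith)
  qed
  \<comment> \<open>The vertical line is traversed upwards for \<open>\<sigma> = 1\<close> and
    downwards for \<open>\<sigma> = -1\<close>, between conjugate endpoints in the right
    half-plane.\<close>
  moreover have "\<sigma> * (u - v) \<in> {0<..<pi}"
  proof -
    define P where "P = Complex e (L/2)"
    have P: "0 < Im (Ln P)" "Im (Ln P) < pi / 2" "Im (Ln (cnj P)) = - Im (Ln P)"
      using Im_Ln_pos_lt_imp[of P] Re_Ln_pos_lt_imp[of P] cnj_Ln[of P, symmetric] e L_pos
      by (auto simp: P_def complex_nonpos_Reals_iff)
    have "of_real e + \<i> * of_real (L/2) = P" "of_real e - \<i> * of_real (L/2) = cnj P"
      by (simp_all add: P_def complex_eq_iff)
    then show ?thesis using P \<sigma> by (auto simp: u_def v_def)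
  qed
  moreover have "Im (G L - G 0) = 0 \<or> Im (G L - G 0) = 2 * pi"
    using log01[OF w G] by (elim disjE; simp only:; simp)
  ultimately show ?thesis
    by (intro exI[of _ "u - v"] exI[of _ y]) auto
qed

text \<open>Moving the base point \<open>\<gamma> a\<close> to its left (\<open>\<sigma> = 1\<close>) or to its right (\<open>\<sigma> = -1\<close>) gives two estimates of the
  same odd multiple of \<open>\<pi>\<close>; they are compatible only if it is \<open>\<pi>\<close> itself.\<close>

lemma secant_half_turn:
  assumes log01: "\<And>w G. \<lbrakk>w \<notin> range \<gamma>; continuous_on UNIV G; \<And>t. exp (G t) = \<gamma> t - w\<rbrakk>
      \<Longrightarrow> G L - G 0 = 0 \<or> G L - G 0 = 2 * pi * \<i>"
    and g: "continuous_on {a - L/2..a + L/2} g" "\<And>t. t \<in> {a - L/2..a + L/2} \<Longrightarrow> exp (g t) = secant \<tau> a t"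
  shows "g (a + L/2) - g (a - L/2) = pi * \<i>"
proof -
  define c where "c = g (a + L/2) - g (a - L/2)"
  \<comment> \<open>Both secants join \<open>\<gamma> a\<close> to the same point, with opposite
    parameter differences, so the two end slopes are negatives of each other.\<close>
  have "\<gamma> (a + L/2) = \<gamma> (a - L/2)"
    using periodic[of "a - L/2"] by (simp add: add.commute)
  then have *: "of_real (L/2) * secant \<tau> a (a + L/2) = \<gamma> (a - L/2) - \<gamma> a"
      "- (of_real (L/2) * secant \<tau> a (a - L/2)) = \<gamma> (a - L/2) - \<gamma> a"
    using secant_mult'[of "a + L/2" a] secant_mult'[of "a - L/2" a] by (simp_all del: of_real_divide)
  have "of_real (L/2) * (secant \<tau> a (a + L/2) + secant \<tau> a (a - L/2)) = 0"
    unfolding distrib_left *(1) *(2)[symmetric] by simp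
  then have "secant \<tau> a (a + L/2) = - secant \<tau> a (a - L/2)"
    using L_pos by (simp add: eq_neg_iff_add_eq_0)
  moreover have "secant \<tau> a (a - L/2) \<noteq> 0"
    using L_pos by (intro secant_nonzero) auto
  ultimately have "exp c = -1"
    using g(2)[of "a + L/2"] g(2)[of "a - L/2"] L_pos by (simp add: c_def exp_diff)
  then have "exp c = exp (of_real pi * \<i>)"
    by simp
  then obtain n :: int where n: "c = of_real pi * \<i> + of_int (2 * n) * of_real pi * \<i>"
    unfolding exp_eq by auto
  have Im_c: "Im c = (2 * of_int n + 1) * pi"
    by (simp add: n algebra_simps)
  have ex: "\<exists>x y. \<sigma> * x \<in> {0<..<pi} \<and> \<bar>y\<bar> < pi \<and> (Im c = - x - y \<or> Im c = 2 * pi - x - y)"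
    if "\<sigma> = 1 \<or> \<sigma> = -1" for \<sigma>
    unfolding c_def by (rule Im_secant_half_turn_bounds[OF that log01 g])
  obtain x y where 1: "1 * x \<in> {0<..<pi}" "\<bar>y\<bar> < pi" "Im c = - x - y \<or> Im c = 2 * pi - x - y"
    using ex[of 1] by blast
  obtain x' y' where 2: "-1 * x' \<in> {0<..<pi}" "\<bar>y'\<bar> < pi" "Im c = - x' - y' \<or> Im c = 2 * pi - x' - y'"
    using ex[of "-1"] by blast
  \<comment> \<open>The upper bound comes from \<open>\<sigma> = 1\<close>, the lower bound from
    \<open>\<sigma> = -1\<close>; strictly between \<open>-pi\<close> and \<open>3 * pi\<close> the
    only odd multiple of \<open>pi\<close> is \<open>pi\<close>.\<close>
  have "Im c < 3 * pi"
    using 1 by (auto simp: abs_less_iff)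
  moreover have "-1 * pi < Im c"
    using 2 by (auto simp: abs_less_iff)
  ultimately have "2 * real_of_int n + 1 < 3" "-1 < 2 * real_of_int n + 1"
    unfolding Im_c by (simp_all only: mult_less_cancel_right_pos pi_gt_zero)
  then have "n = 0" by linarith
  then show ?thesis by (simp add: n c_def[symmetric])
qed

text \<open>Hopf's argument: on the convex strip \<open>\<bar>t - s\<bar> < L\<close> the secant slope has a continuous logarithm, whose
  increment along the diagonal equals that along a vertical and a horizontal segment, half a turn each.\<close>

theorem turning_number:
  assumes log01: "\<And>w G. \<lbrakk>w \<notin> range \<gamma>; continuous_on UNIV G; \<And>t. exp (G t) = \<gamma> t - w\<rbrakk>
      \<Longrightarrow> G L - G 0 = 0 \<or> G L - G 0 = 2 * pi * \<i>"
    and \<tau>': "\<And>s. (\<tau> has_vector_derivative \<tau>' s) (at s)" "continuous_on UNIV \<tau>'"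
  shows "((\<lambda>s. \<tau>' s / \<tau> s) has_integral (2 * pi * \<i>)) {0..L}"
proof -
  define S :: "(real \<times> real) set" where "S = {p. \<bar>snd p - fst p\<bar> < L}"
  have "S = {p. snd p - fst p < L} \<inter> {p. fst p - snd p < L}"
    by (auto simp: S_def)
  moreover have "convex {p :: real \<times> real. snd p - fst p < L}" "convex {p :: real \<times> real. fst p - snd p < L}"
    using convex_halfspace_lt[of "(-1, 1) :: real \<times> real" L] convex_halfspace_lt[of "(1, -1) :: real \<times> real" L]
    by (simp_all add: inner_prod_def)
  ultimately have S: "convex S"
    by (simp add: convex_Int)
  obtain g where g: "continuous_on S g" "\<And>p. p \<in> S \<Longrightarrow> secant \<tau> (fst p) (snd p) = exp (g p)"
    using continuous_logarithm_on_contractible[OF continuous_on_subset[OF continuous_on_secant[OF cont_deriv] subset_UNIV[of S]]]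
      convex_imp_contractible[OF S] secant_nonzero unfolding S_def by auto
  \<comment> \<open>By symmetry of the secant slope, this horizontal segment is a half turn with
    base point \<open>L/2\<close>.\<close>
  have "g ((L, L/2) :: real \<times> real) - g (0, L/2) = pi * \<i>"
  proof -
    have "continuous_on {L/2 - L/2..L/2 + L/2} (\<lambda>s. g (s, L/2))"
      by (rule continuous_on_compose2[OF g(1)]) (use L_pos in \<open>auto intro!: continuous_intros simp: S_def abs_if\<close>)
    from secant_half_turn[OF log01 this] show ?thesis
      using g(2)[of "(_, L/2)"] secant_commute L_pos by (auto simp: S_def abs_if)
  qed
  moreover have "g (0, L/2) - g (0, - L/2) = pi * \<i>"
  proof -
    have "continuous_on {0 - L/2..0 + L/2} (\<lambda>t. g (0, t))"
      by (rule continuous_on_compose2[OF g(1)]) (use L_pos in \<open>auto intro!: continuous_intros simp: S_def abs_if\<close>)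
    from secant_half_turn[OF log01 this] show ?thesis
      using g(2)[of "(0, _)"] L_pos by (auto simp: S_def abs_if)
  qed
  \<comment> \<open>Periodicity carries the last vertical piece, from \<open>(L, L/2)\<close> to
    \<open>(L, L)\<close>, back to the one from \<open>(0, - L/2)\<close> to \<open>(0, 0)\<close>.
    Together with the piece from \<open>(0, 0)\<close> to \<open>(0, L/2)\<close> it forms the half
    turn with base point 0.\<close>
  moreover have "g ((0, 0) + (L, L)) - g ((0, - L/2) + (L, L)) = g (0, 0) - g (0, - L/2)"
  proof (rule log_increment_unique[of S "\<lambda>p. g (p + (L, L))"])
    show "continuous_on S (\<lambda>p. g (p + (L, L)))"
      by (rule continuous_on_compose2[OF g(1)]) (auto intro!: continuous_intros simp: S_def)
    show "exp (g (p + (L, L))) = exp (g p)" if "p \<in> S" for p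
      using that g(2)[of p] g(2)[of "p + (L, L)"] secant_shift[of "fst p" "snd p"] by (simp add: S_def)
  qed (use S g L_pos in \<open>auto simp: S_def convex_connected abs_if\<close>)
  ultimately have "g (L, L) - g (0, 0) = 2 * pi * \<i>"
    by (simp add: algebra_simps)
  moreover have "((\<lambda>s. \<tau>' s / \<tau> s) has_integral (g (L, L) - g (0, 0))) {0..L}"
  proof (rule has_integral_log_derivative[where G = "\<lambda>s. g (s, s)"])
    show "continuous_on {0..L} (\<lambda>s. g (s, s))"
      by (rule continuous_on_compose2[OF g(1)]) (use L_pos in \<open>auto intro!: continuous_intros simp: S_def\<close>)
    show "exp (g (s, s)) = \<tau> s" for s
      using g(2)[of "(s, s)"] L_pos by (simp add: S_def)
  qed (use L_pos \<tau>' continuous_on_subset[OF \<tau>'(2)] in \<open>auto intro: has_vector_derivative_at_within\<close>)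
  ultimately show ?thesis by simp
qed

end

section \<open>The isoperimetric inequality\<close>

text \<open>Inversion takes the half-plane of imaginary parts above \<open>t\<close> to a disc whose
  boundary circle passes through \<open>z\<close>. Clearing the denominator and completing the
  square gives its centre and radius.\<close>

lemma Im_divide_gt_subset_ball:
  fixes \<tau> z :: complex
  assumes "norm \<tau> = 1" "t > 0"
  shows "{w. Im (\<tau> / (z - w)) > t} \<subseteq> ball (z + \<i> * \<tau> / of_real (2 * t)) (1 / (2 * t))"
proof
  fix w assume "w \<in> {w. Im (\<tau> / (z - w)) > t}"
  then have w: "t < Im (\<tau> / (z - w))" by simp
  obtain a b where ab: "z - w = Complex a b" by (cases "z - w")
  obtain c d where cd: "\<tau> = Complex c d" by (cases \<tau>)
  have cd1: "c\<^sup>2 + d\<^sup>2 = 1"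
    using assms(1) by (simp add: cd cmod_def)
  have nz: "a\<^sup>2 + b\<^sup>2 > 0"
  proof -
    have "z \<noteq> w" using w \<open>t > 0\<close> by auto
    then show ?thesis using ab by (auto simp: sum_power2_gt_zero_iff complex_eq_iff)
  qed
  have "t < (d * a - c * b) / (a\<^sup>2 + b\<^sup>2)"
    using w by (simp add: ab cd Im_divide)
  then have *: "t * (a\<^sup>2 + b\<^sup>2) < d * a - c * b"
    using nz by (simp add: pos_less_divide_eq)
  have "(z + \<i> * \<tau> / of_real (2 * t)) - w = Complex (a - d / (2 * t)) (b + c / (2 * t))"
    using ab cd by (auto simp: complex_eq_iff Im_divide Re_divide power2_eq_square)
  then have "(dist (z + \<i> * \<tau> / of_real (2 * t)) w)\<^sup>2 = (a - d / (2 * t))\<^sup>2 + (b + c / (2 * t))\<^sup>2"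
    by (simp add: dist_norm cmod_power2)
  also have "\<dots> = (a\<^sup>2 + b\<^sup>2) - (d * a - c * b) / t + (c\<^sup>2 + d\<^sup>2) / (2 * t)\<^sup>2"
    using \<open>t > 0\<close> by (simp add: field_simps power2_eq_square)
  also have "\<dots> < (1 / (2 * t))\<^sup>2"
  proof -
    have "a\<^sup>2 + b\<^sup>2 < (d * a - c * b) / t"
      using * \<open>t > 0\<close> by (simp add: pos_less_divide_eq mult.commute)
    then show ?thesis by (simp add: cd1 power_divide)
  qed
  finally show "w \<in> ball (z + \<i> * \<tau> / of_real (2 * t)) (1 / (2 * t))"
    using \<open>t > 0\<close> by (auto intro: power2_less_imp_less)
qed

lemma ennreal_eq_nn_integral_layers:
  "ennreal x = (\<integral>\<^sup>+t. indicator {0<..<x} t \<partial>lborel)"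
  by (cases "x \<ge> 0") (auto simp: ennreal_neg)

lemma nn_integral_inverse_square_tail:
  assumes "a > 0" "c \<ge> 0"
  shows "(\<integral>\<^sup>+t. ennreal (c / t\<^sup>2) * indicator {a..} t \<partial>lborel) = ennreal (c / a)"
proof -
  have "(\<integral>\<^sup>+t. ennreal (c / t\<^sup>2) * indicator {a..} t \<partial>lborel) = ennreal (0 - (- c / a))"
  proof (rule nn_integral_FTC_atLeast)
    show "((\<lambda>t. - c / t) \<longlongrightarrow> 0) at_top"
      by real_asymp
    fix t assume "a \<le> t"
    then show "((\<lambda>t. - c / t) has_real_derivative c / t\<^sup>2) (at t)" 
      using assms by (auto intro!: derivative_eq_intros simp: power2_eq_square)
  qed (use assms in auto)
  then show ?thesis by simp
qed

text \<open>By the layer-cake formula the integral is \<open>\<integral> \<bar>E \<inter> {f > t}\<bar> dt\<close>; the set \<open>{f > t}\<close> lies in a disc of area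
  \<open>\<pi> / (4 t\<^sup>2)\<close>, so the integrand is at most \<open>min A (\<pi> / (4 t\<^sup>2))\<close>, with the switch at \<open>t = \<surd>(\<pi> / (4 A))\<close>.\<close>

lemma Ahlfors_Beurling:
  fixes E :: "complex set"
  assumes E: "E \<in> sets borel" "emeasure lborel E = ennreal A" "A > 0" and \<tau>: "norm \<tau> = 1"
  shows "(\<integral>\<^sup>+w. ennreal (Im (\<tau> / (z - w))) * indicator E w \<partial>lborel) \<le> ennreal (sqrt (pi * A))"
proof -
  define f where "f w = Im (\<tau> / (z - w))" for w
  have [measurable]: "f \<in> borel_measurable borel" "E \<in> sets borel"
    unfolding f_def using E by measurable
  define a where "a = sqrt (pi / (4 * A))"
  have a: "a > 0" using E by (simp add: a_def)
  have "(\<integral>\<^sup>+w. ennreal (f w) * indicator E w \<partial>lborel)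
      = (\<integral>\<^sup>+w. (\<integral>\<^sup>+t. indicator {0<..<f w} t * indicator E w \<partial>lborel) \<partial>lborel)"
    by (simp add: ennreal_eq_nn_integral_layers nn_integral_multc)
  also have "\<dots> = (\<integral>\<^sup>+t. (\<integral>\<^sup>+w. indicator {0<..<f w} t * indicator E w \<partial>lborel) \<partial>lborel)"
    by (rule lborel_pair.Fubini') (simp add: indicator_def, measurable)
  also have "\<dots> \<le> (\<integral>\<^sup>+t. ennreal A * indicator {0..a} t + ennreal (pi / 4 / t\<^sup>2) * indicator {a..} t \<partial>lborel)"
  proof (rule nn_integral_mono)
    fix t
    let ?I = "\<integral>\<^sup>+w. indicator {0<..<f w} t * indicator E w \<partial>lborel"
    show "?I \<le> ennreal A * indicator {0..a} t + ennreal (pi / 4 / t\<^sup>2) * indicator {a..} t"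
    proof (cases "t > 0")
      case False
      then show ?thesis by simp
    next
      case True
      have "?I = (\<integral>\<^sup>+w. indicator {w. f w > t} w * indicator E w \<partial>lborel)"
        using True by (intro nn_integral_cong) (auto simp: indicator_def)
      also have "\<dots> = emeasure lborel ({w. f w > t} \<inter> E)"
        by (subst indicator_inter_arith[symmetric]) simp
      finally have eq: "?I = emeasure lborel ({w. f w > t} \<inter> E)" .
      have "?I \<le> ennreal A"
        unfolding eq E(2)[symmetric] by (rule emeasure_mono) auto
      moreover have "?I \<le> ennreal (pi / 4 / t\<^sup>2)"
      proof -
        have "?I \<le> emeasure lborel (ball (z + \<i> * \<tau> / of_real (2 * t)) (1 / (2 * t)))"
          unfolding eq using Im_divide_gt_subset_ball[OF \<tau> True, of z]
          by (intro emeasure_mono) (auto simp: f_def)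
        also have "\<dots> = ennreal (pi / 4 / t\<^sup>2)"
          using True by (simp add: emeasure_ball unit_ball_vol_2 power_divide field_simps power2_eq_square)
        finally show ?thesis .
      qed
      ultimately show ?thesis
        using True by (auto simp: indicator_def intro: order_trans add_increasing2)
    qed
  qed
  also have "\<dots> = ennreal (A * a) + ennreal (pi / 4 / a)"
    using a E nn_integral_inverse_square_tail[of a "pi / 4"]
    by (subst nn_integral_add) (auto simp: nn_integral_cmult_indicator ennreal_mult)
  also have "\<dots> = ennreal (A * a + pi / 4 / a)"
    using a E by (simp add: ennreal_plus)
  also have "A * a + pi / 4 / a = sqrt (pi * A)"
  proof -
    have "a * a = pi / (4 * A)" using E by (simp add: a_def)
    then have "pi / 4 / a = A * a"
      using a E by (simp add: field_simps)
    moreover have "sqrt (pi * A) = 2 * A * a"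
      using \<open>a * a = _\<close> a E by (intro real_sqrt_unique) (auto simp: power2_eq_square field_simps)
    ultimately show ?thesis by simp
  qed
  finally show ?thesis unfolding f_def .
qed

text \<open>The curve only has to wind once about each point of \<open>E\<close>, so
  \<open>E\<close> may be a domain with holes and need not fill the interior.\<close>

theorem isoperimetric_of_winding:
  fixes E :: "complex set" and \<gamma> \<tau> :: "real \<Rightarrow> complex"
  assumes E: "E \<in> sets borel" "emeasure lborel E = ennreal A" "A > 0" and "L > 0"
    and cont: "continuous_on UNIV \<gamma>" "continuous_on UNIV \<tau>" and \<tau>: "\<And>s. norm (\<tau> s) = 1"
    and off: "\<And>w s. w \<in> E \<Longrightarrow> \<gamma> s \<noteq> w"
    and winding: "\<And>w. w \<in> E \<Longrightarrow> ((\<lambda>s. \<tau> s / (\<gamma> s - w)) has_integral (2 * pi * \<i>)) {0..L}"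
  shows "4 * pi * A \<le> L\<^sup>2"
proof -
  have [measurable]: "\<gamma> \<in> borel_measurable borel" "\<tau> \<in> borel_measurable borel" "E \<in> sets borel"
    using cont E by (auto intro: borel_measurable_continuous_onI)
  define f where "f w s = Im (\<tau> s / (\<gamma> s - w))" for w s
  have [measurable]: "(\<lambda>p. f (fst p) (snd p)) \<in> borel_measurable (borel \<Otimes>\<^sub>M borel)"
    unfolding f_def by measurable
  \<comment> \<open>Coercion to \<open>ennreal\<close> cuts off the negative part of
    \<open>f w\<close>, so the equality given by the winding integral becomes a lower bound.\<close>
  have lower: "ennreal (2 * pi) \<le> (\<integral>\<^sup>+s. ennreal (f w s) * indicator {0..L} s \<partial>lborel)" if "w \<in> E" for w
  proof -
    have contf: "continuous_on {0..L} (f w)"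
      unfolding f_def using off[OF that]
      by (intro continuous_intros continuous_on_subset[OF cont(1)] continuous_on_subset[OF cont(2)]) auto
    have "(f w has_integral (2 * pi)) {0..L}"
      using has_integral_Im[OF winding[OF that]] by (simp add: f_def[abs_def])
    moreover have int: "((\<lambda>s. max 0 (f w s)) has_integral integral {0..L} (\<lambda>s. max 0 (f w s))) {0..L}"
      by (intro integrable_integral integrable_continuous_interval continuous_intros contf)
    ultimately have "2 * pi \<le> integral {0..L} (\<lambda>s. max 0 (f w s))"
      by (rule has_integral_le) simp
    moreover have "(\<integral>\<^sup>+s. ennreal (indicator {0..L} s * max 0 (f w s)) \<partial>lborel) = ennreal (integral {0..L} (\<lambda>s. max 0 (f w s)))"
    proof (rule nn_integral_has_integral_lborel)
      show "(\<lambda>s. indicator {0..L} s * max 0 (f w s)) \<in> borel_measurable borel"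
        unfolding f_def by measurable
      have "((\<lambda>s. if s \<in> {0..L} then max 0 (f w s) else 0) has_integral integral {0..L} (\<lambda>s. max 0 (f w s))) UNIV"
        using int by (simp only: has_integral_restrict_UNIV)
      then show "((\<lambda>s. indicator {0..L} s * max 0 (f w s)) has_integral integral {0..L} (\<lambda>s. max 0 (f w s))) UNIV"
        by (rule has_integral_eq[rotated]) (auto simp: indicator_def)
    qed (simp add: indicator_def)
    moreover have "ennreal (indicator {0..L} s * max 0 (f w s)) = ennreal (f w s) * indicator {0..L} s" for s
      by (auto simp: indicator_def max_def ennreal_neg)
    ultimately show ?thesis by (metis (no_types, lifting) ennreal_leI nn_integral_cong)
  qed
  have "ennreal (2 * pi) * ennreal A = (\<integral>\<^sup>+w. ennreal (2 * pi) * indicator E w \<partial>lborel)"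
    using E by (simp add: nn_integral_cmult_indicator)
  also have "\<dots> \<le> (\<integral>\<^sup>+w. (\<integral>\<^sup>+s. ennreal (f w s) * indicator {0..L} s * indicator E w \<partial>lborel) \<partial>lborel)"
  proof (rule nn_integral_mono)
    fix w show "ennreal (2 * pi) * indicator E w \<le> (\<integral>\<^sup>+s. ennreal (f w s) * indicator {0..L} s * indicator E w \<partial>lborel)"
      using lower[of w] by (cases "w \<in> E") auto
  qed
  also have "\<dots> = (\<integral>\<^sup>+s. (\<integral>\<^sup>+w. ennreal (f w s) * indicator {0..L} s * indicator E w \<partial>lborel) \<partial>lborel)"
    by (rule lborel_pair.Fubini') (unfold f_def, measurable)
  also have "\<dots> = (\<integral>\<^sup>+s. (\<integral>\<^sup>+w. ennreal (f w s) * indicator E w \<partial>lborel) * indicator {0..L} s \<partial>lborel)"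
    by (intro nn_integral_cong) (auto simp: indicator_def)
  also have "\<dots> \<le> (\<integral>\<^sup>+s. ennreal (sqrt (pi * A)) * indicator {0..L} s \<partial>lborel)"
    using Ahlfors_Beurling[OF E \<tau>] by (intro nn_integral_mono mult_right_mono) (auto simp: f_def)
  also have "\<dots> = ennreal (sqrt (pi * A)) * ennreal L"
    using \<open>L > 0\<close> by (simp add: nn_integral_cmult_indicator)
  finally have "2 * pi * A \<le> sqrt (pi * A) * L"
    using E \<open>L > 0\<close> by (simp flip: ennreal_mult)
  then have "2 * sqrt (pi * A) * sqrt (pi * A) \<le> L * sqrt (pi * A)"
    using E by (simp add: algebra_simps)
  then have "2 * sqrt (pi * A) \<le> L"
    using E by (subst (asm) mult_le_cancel_right_pos) auto
  then have "(2 * sqrt (pi * A))\<^sup>2 \<le> L\<^sup>2"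
    using E by (intro power_mono) auto
  then show ?thesis
    using E by (simp add: power_mult_distrib)
qed

section \<open>Differentiation along the boundary\<close>

text \<open>Convergence of the power series at a real point \<open>x\<close> forces convergence at
  every complex point of smaller modulus, so the curve extends holomorphically to a disc.\<close>

lemma real_analytic_curve_local:
  assumes "real_analytic_curve \<gamma>"
  obtains r f where "r > 0" "f holomorphic_on ball 0 r"
    "\<And>s. \<bar>s - s0\<bar> < r \<Longrightarrow> \<gamma> s = f (of_real (s - s0))"
proof -
  obtain r c where r: "r > 0"
    and sums: "\<And>s. \<bar>s - s0\<bar> < r \<Longrightarrow> (\<lambda>m. c m * of_real ((s - s0) ^ m)) sums \<gamma> s"
    using assms unfolding real_analytic_curve_def by blast
  define f where "f z = (\<Sum>m. c m * z ^ m)" for z :: complex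
  have summable: "summable (\<lambda>m. c m * z ^ m)" if z: "norm z < r" for z :: complex
  proof -
    obtain x where x: "norm z < x" "x < r" using dense[OF z] by blast
    have "x \<ge> 0" using x(1) norm_ge_zero[of z] by linarith
    then have "summable (\<lambda>m. c m * of_real x ^ m)"
      using sums[of "s0 + x"] x by (auto simp: sums_iff)
    then show ?thesis
      by (rule powser_inside) (use x \<open>x \<ge> 0\<close> in auto)
  qed
  show ?thesis
  proof
    show "r > 0" by (rule r)
    show "f holomorphic_on ball 0 r"
      by (rule power_series_holomorphic[where a = c]) (auto simp: f_def intro: summable_sums summable)
    fix s assume "\<bar>s - s0\<bar> < r"
    from sums[OF this] show "\<gamma> s = f (of_real (s - s0))"
      by (simp add: f_def sums_iff)
  qed
qed

lemma holomorphic_shift_has_vector_derivative: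
  assumes f: "f holomorphic_on ball 0 r" and s: "\<bar>s - s0\<bar> < r"
    and eq: "\<And>t. \<bar>t - s0\<bar> < r \<Longrightarrow> \<gamma> t = f (of_real (t - s0))"
  shows "(\<gamma> has_vector_derivative deriv f (of_real (s - s0))) (at s)"
proof -
  have "(f has_field_derivative deriv f (of_real (s - s0))) (at (of_real (s - s0)))"
    by (rule holomorphic_derivI[OF f]) (use s in \<open>auto simp flip: of_real_diff\<close>)
  moreover have "((\<lambda>t. of_real (t - s0) :: complex) has_vector_derivative 1) (at s)"
    by (auto intro!: derivative_eq_intros)
  ultimately have "((\<lambda>t. f (of_real (t - s0))) has_vector_derivative deriv f (of_real (s - s0))) (at s)"
    using field_vector_diff_chain_at[of "\<lambda>t. of_real (t - s0)" 1 s f] by (simp add: o_def)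
  then show ?thesis
    by (rule has_vector_derivative_transform_within_open[where S = "ball s0 r"])
      (use s eq in \<open>auto simp: dist_real_def\<close>)
qed

lemma real_analytic_curve_smooth:
  assumes \<gamma>: "real_analytic_curve \<gamma>"
  shows "(\<gamma> has_vector_derivative tangent \<gamma> s) (at s)"
    and "(tangent \<gamma> has_vector_derivative vector_derivative (tangent \<gamma>) (at s)) (at s)"
    and "continuous_on UNIV (\<lambda>s. vector_derivative (tangent \<gamma>) (at s))"
proof -
  have loc: "(\<gamma> has_vector_derivative tangent \<gamma> s0) (at s0) \<and>
     (tangent \<gamma> has_vector_derivative vector_derivative (tangent \<gamma>) (at s0)) (at s0) \<and>
     isCont (\<lambda>s. vector_derivative (tangent \<gamma>) (at s)) s0" for s0
  proof -
    obtain r f where r: "r > 0" and f: "f holomorphic_on ball 0 r"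
      and eq: "\<And>s. \<bar>s - s0\<bar> < r \<Longrightarrow> \<gamma> s = f (of_real (s - s0))"
      using real_analytic_curve_local[OF \<gamma>, of s0] by blast
    have f': "deriv f holomorphic_on ball 0 r" "deriv (deriv f) holomorphic_on ball 0 r"
      by (simp_all add: f holomorphic_deriv)
    have 1: "(\<gamma> has_vector_derivative deriv f (of_real (s - s0))) (at s)" if "\<bar>s - s0\<bar> < r" for s
      by (rule holomorphic_shift_has_vector_derivative[OF f that eq])
    then have tangent: "tangent \<gamma> s = deriv f (of_real (s - s0))" if "\<bar>s - s0\<bar> < r" for s
      unfolding tangent_def using that by (simp add: vector_derivative_at)
    then have 2: "(tangent \<gamma> has_vector_derivative deriv (deriv f) (of_real (s - s0))) (at s)" if "\<bar>s - s0\<bar> < r" for s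
      by (rule holomorphic_shift_has_vector_derivative[OF f'(1) that])
    have 3: "vector_derivative (tangent \<gamma>) (at s) = deriv (deriv f) (of_real (s - s0))" if "\<bar>s - s0\<bar> < r" for s
      by (rule vector_derivative_at[OF 2[OF that]])
    have "continuous_on (ball s0 r) (\<lambda>s. deriv (deriv f) (of_real (s - s0)))"
      by (rule continuous_on_compose2[OF holomorphic_on_imp_continuous_on[OF f'(2)]])
        (auto intro!: continuous_intros simp: dist_real_def simp flip: of_real_diff)
    then have "continuous_on (ball s0 r) (\<lambda>s. vector_derivative (tangent \<gamma>) (at s))"
      by (rule continuous_on_cong[THEN iffD1, rotated 2]) (auto simp: 3 dist_real_def)
    then have "isCont (\<lambda>s. vector_derivative (tangent \<gamma>) (at s)) s0"
      using r by (simp add: continuous_on_eq_continuous_at)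
    then show ?thesis
      using 1[of s0] 2[of s0] tangent[of s0] 3[of s0] r by simp
  qed
  show "(\<gamma> has_vector_derivative tangent \<gamma> s) (at s)"
    "(tangent \<gamma> has_vector_derivative vector_derivative (tangent \<gamma>) (at s)) (at s)"
    using loc by blast+
  show "continuous_on UNIV (\<lambda>s. vector_derivative (tangent \<gamma>) (at s))"
    using loc by (intro continuous_at_imp_continuous_on) blast
qed

section \<open>One-sided approach to boundary points and the boundary chain rule\<close>

lemma connected_subset_or_disjoint:
  assumes "connected S" "S \<inter> frontier T = {}"
  shows "S \<subseteq> T \<or> S \<inter> T = {}"
proof (rule ccontr)
  assume "\<not> ?thesis"
  then have "S \<inter> T \<noteq> {}" "S - T \<noteq> {}" by auto
  from connected_Int_frontier[OF assms(1) this] assms(2) show False by contradiction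
qed

text \<open>The normal translates \<open>\<gamma> s + i t \<tau> a\<close> parametrise a neighbourhood of \<open>\<gamma> a\<close>, and each of the two half
  boxes \<open>t > 0\<close>, \<open>t < 0\<close> misses the boundary, hence lies in the domain or misses it.\<close>

lemma one_sided_collar:
  fixes \<gamma> \<tau> :: "real \<Rightarrow> complex"
  assumes \<Omega>: "open \<Omega>" and deriv: "\<And>s. (\<gamma> has_vector_derivative \<tau> s) (at s)"
    and cont: "continuous_on UNIV \<tau>" and nz: "\<tau> a \<noteq> 0"
    and bdry: "\<And>s. \<gamma> s \<in> frontier \<Omega>"
    and locality: "\<And>\<delta>. \<delta> > 0 \<Longrightarrow> \<exists>\<rho>>0. frontier \<Omega> \<inter> ball (\<gamma> a) \<rho> \<subseteq> \<gamma> ` ball a \<delta>"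
  obtains \<eta> \<nu> where "\<eta> > 0" "\<And>s t. \<lbrakk>\<bar>s - a\<bar> < \<eta>; 0 < t; t < \<eta>\<rbrakk> \<Longrightarrow> \<gamma> s + of_real t * \<nu> \<in> \<Omega>"
proof -
  have cont\<gamma>: "continuous_on S \<gamma>" for S
    by (intro continuous_at_imp_continuous_on ballI has_vector_derivative_continuous[OF deriv])
  define \<Phi> where "\<Phi> p = \<gamma> (fst p) + of_real (snd p) * (\<i> * \<tau> a)" for p
  have cont\<Phi>: "continuous_on S \<Phi>" for S
    unfolding \<Phi>_def by (intro continuous_intros continuous_on_compose2[OF cont\<gamma>[of UNIV]]) auto
  \<comment> \<open>This is, up to a positive factor, the coordinate along the tangent at
    \<open>a\<close>. It is strictly increasing near \<open>a\<close> and unchanged by normal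
    translation, which makes \<open>\<Phi>\<close> injective.\<close>
  define h where "h s = Re (cnj (\<tau> a) * \<gamma> s)" for s
  have h: "(h has_real_derivative Re (cnj (\<tau> a) * \<tau> s)) (at s)" for s
    unfolding h_def has_real_derivative_iff_has_vector_derivative
    by (intro bounded_linear.has_vector_derivative[OF bounded_linear_Re] has_vector_derivative_mult_right deriv)
  have "Re (cnj (\<tau> a) * \<tau> a) = (norm (\<tau> a))\<^sup>2"
    by (simp add: cmod_power2) (simp add: power2_eq_square)
  then have pos: "Re (cnj (\<tau> a) * \<tau> a) > 0" using nz by simp
  have "open {s. 0 < Re (cnj (\<tau> a) * \<tau> s)}"
    by (intro open_Collect_less continuous_intros cont)
  then obtain \<delta> where \<delta>: "\<delta> > 0" "ball a \<delta> \<subseteq> {s. 0 < Re (cnj (\<tau> a) * \<tau> s)}"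
    using pos unfolding open_contains_ball by blast
  have h'_pos: "Re (cnj (\<tau> a) * \<tau> s) > 0" if "\<bar>s - a\<bar> < \<delta>" for s
    using \<delta>(2) that by (auto simp: dist_real_def abs_minus_commute)
  have h_mono: "h s < h t" if "s < t" "\<bar>s - a\<bar> < \<delta>" "\<bar>t - a\<bar> < \<delta>" for s t
  proof (rule DERIV_pos_imp_increasing[OF that(1)])
    fix x assume "s \<le> x" "x \<le> t"
    then have "\<bar>x - a\<bar> < \<delta>" using that by auto
    then show "\<exists>y. (h has_real_derivative y) (at x) \<and> 0 < y"
      using h h'_pos by blast
  qed
  have h_\<Phi>: "Re (cnj (\<tau> a) * \<Phi> p) = h (fst p)" for p
    by (simp add: \<Phi>_def h_def algebra_simps)
  have \<Phi>_inj: "p = q" if "\<Phi> p = \<Phi> q" "\<bar>fst p - a\<bar> < \<delta>" "\<bar>fst q - a\<bar> < \<delta>" for p q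
  proof -
    have "h (fst p) = h (fst q)" using that h_\<Phi> by metis
    then have "fst p = fst q"
      using h_mono[of "fst p" "fst q"] h_mono[of "fst q" "fst p"] that(2,3)
      by (cases "fst p" "fst q" rule: linorder_cases) auto
    moreover from this have "snd p = snd q"
      using that(1) nz by (simp add: \<Phi>_def)
    ultimately show ?thesis by (simp add: prod_eq_iff)
  qed
  obtain \<rho> where \<rho>: "\<rho> > 0" "frontier \<Omega> \<inter> ball (\<gamma> a) \<rho> \<subseteq> \<gamma> ` ball a \<delta>"
    using locality[OF \<delta>(1)] by blast
  have "\<Phi> (a, 0) = \<gamma> a" by (simp add: \<Phi>_def)
  moreover have "isCont \<Phi> (a, 0)"
    using cont\<Phi>[of UNIV] by (simp add: continuous_on_eq_continuous_at)
  ultimately obtain d where d: "d > 0" "\<And>p. dist p (a, 0) < d \<Longrightarrow> \<Phi> p \<in> ball (\<gamma> a) \<rho>"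
    using \<rho>(1) unfolding continuous_at_eps_delta mem_ball dist_commute[of "\<gamma> a"] by auto
  define \<eta> where "\<eta> = min \<delta> (d / 2)"
  have \<eta>: "\<eta> > 0" "\<eta> \<le> \<delta>" using \<delta> d by (auto simp: \<eta>_def)
  have near: "\<Phi> (s, t) \<in> ball (\<gamma> a) \<rho>" if "\<bar>s - a\<bar> < \<eta>" "\<bar>t\<bar> < \<eta>" for s t
  proof (rule d(2))
    have "dist (s, t) (a, 0) \<le> \<bar>s - a\<bar> + \<bar>t\<bar>"
      using sqrt_sum_squares_le_sum_abs[of "s - a" t] by (simp add: dist_Pair_Pair dist_real_def)
    then show "dist (s, t) (a, 0) < d" using that by (simp add: \<eta>_def)
  qed
  define B where "B = {a - \<eta><..<a + \<eta>} \<times> {- \<eta><..<\<eta>}"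
  define U where "U T = \<Phi> ` ({a - \<eta><..<a + \<eta>} \<times> T)" for T
  have U: "U T \<subseteq> \<Omega> \<or> U T \<inter> \<Omega> = {}" if "connected T" "T \<subseteq> {- \<eta><..<\<eta>}" "0 \<notin> T" for T
  proof (rule connected_subset_or_disjoint)
    show "connected (U T)"
      unfolding U_def by (intro connected_continuous_image cont\<Phi> connected_Times that connected_Ioo)
    show "U T \<inter> frontier \<Omega> = {}"
    proof (rule ccontr)
      assume "U T \<inter> frontier \<Omega> \<noteq> {}"
      then obtain s t where s: "s \<in> {a - \<eta><..<a + \<eta>}" and t: "t \<in> T" "\<Phi> (s, t) \<in> frontier \<Omega>"
        unfolding U_def by blast
      have st: "\<bar>s - a\<bar> < \<eta>" "t \<in> T" "\<Phi> (s, t) \<in> frontier \<Omega>"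
        using s t by (auto simp: abs_less_iff)
      have "\<bar>t\<bar> < \<eta>" using subsetD[OF that(2) st(2)] by (auto simp: abs_less_iff)
      then have "\<Phi> (s, t) \<in> \<gamma> ` ball a \<delta>"
        using near[OF st(1)] st(3) \<rho>(2) by blast
      then obtain s' where s': "s' \<in> ball a \<delta>" "\<Phi> (s, t) = \<gamma> s'"
        by blast
      then have "(s, t) = (s', 0)"
        using st(1) \<eta> by (intro \<Phi>_inj) (auto simp: \<Phi>_def dist_real_def abs_minus_commute)
      then show False using st(2) that by simp
    qed
  qed
  \<comment> \<open>Invariance of domain makes the image a neighbourhood of the boundary point
    \<open>\<gamma> a\<close>, so it meets the domain; the side on which this happens decides the
    sign of \<open>\<nu>\<close>.\<close>
  have "open (\<Phi> ` B)"
  proof (rule invariance_of_domain_gen)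
    show "open B" unfolding B_def by (intro open_Times) auto
    show "inj_on \<Phi> B"
      using \<eta> by (intro inj_onI \<Phi>_inj) (auto simp: B_def)
  qed (auto simp: cont\<Phi>)
  moreover have "\<gamma> a \<in> \<Phi> ` B"
    using imageI[of "(a, 0)" B \<Phi>] \<eta> by (simp add: B_def \<Phi>_def)
  moreover have "\<gamma> a \<in> closure \<Omega>"
    using bdry[of a] by (simp add: frontier_def)
  ultimately have "\<Phi> ` B \<inter> \<Omega> \<noteq> {}"
    using open_Int_closure_eq_empty[of "\<Phi> ` B" \<Omega>] by blast
  then obtain p where p: "p \<in> B" "\<Phi> p \<in> \<Omega>"
    by blast
  have "snd p \<noteq> 0"
  proof
    assume "snd p = 0"
    then have "\<Phi> p \<in> frontier \<Omega>" using bdry by (simp add: \<Phi>_def)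
    then show False using p(2) \<Omega> by (simp add: frontier_def interior_open)
  qed
  then consider "snd p > 0" | "snd p < 0" by linarith
  then show ?thesis
  proof cases
    case 1
    then have "\<Phi> p \<in> U {0<..<\<eta>}"
      unfolding U_def using p(1) by (intro imageI) (auto simp: B_def mem_Times_iff)
    then have *: "U {0<..<\<eta>} \<subseteq> \<Omega>" using U[of "{0<..<\<eta>}"] p(2) \<eta>(1) by fastforce
    have "\<gamma> s + of_real t * (\<i> * \<tau> a) \<in> \<Omega>" if "\<bar>s - a\<bar> < \<eta>" "0 < t" "t < \<eta>" for s t
    proof -
      have "\<Phi> (s, t) \<in> U {0<..<\<eta>}"
        using that unfolding U_def by (intro imageI) auto
      then show ?thesis using * by (auto simp: \<Phi>_def)
    qed
    then show ?thesis by (rule that[OF \<eta>(1)])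
  next
    case 2
    then have "\<Phi> p \<in> U {- \<eta><..<0}"
      unfolding U_def using p(1) by (intro imageI) (auto simp: B_def mem_Times_iff)
    then have *: "U {- \<eta><..<0} \<subseteq> \<Omega>" using U[of "{- \<eta><..<0}"] p(2) \<eta>(1) by fastforce
    have "\<gamma> s + of_real t * (- (\<i> * \<tau> a)) \<in> \<Omega>" if "\<bar>s - a\<bar> < \<eta>" "0 < t" "t < \<eta>" for s t
    proof -
      have "\<Phi> (s, - t) \<in> U {- \<eta><..<0}"
        using that unfolding U_def by (intro imageI) auto
      then show ?thesis using * by (auto simp: \<Phi>_def)
    qed
    then show ?thesis by (rule that[OF \<eta>(1)])
  qed
qed

text \<open>Complex differentiability of \<open>\<phi>\<close> is available only inside the domain.
  The mean value estimate is therefore made on the translated curves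
  \<open>\<gamma> s + t * \<nu>\<close>, uniformly in small \<open>t > 0\<close>, and passes to the
  limit as \<open>t\<close> tends to 0.\<close>

lemma boundary_chain_rule:
  fixes \<gamma> \<tau> :: "real \<Rightarrow> complex"
  assumes \<phi>: "\<And>z. z \<in> \<Omega> \<Longrightarrow> (\<phi> has_field_derivative \<phi>' z) (at z)"
    and cont: "continuous_on (closure \<Omega>) \<phi>" "continuous_on (closure \<Omega>) \<phi>'"
    and \<gamma>: "\<And>s. (\<gamma> has_vector_derivative \<tau> s) (at s)" "\<And>s. norm (\<tau> s) = 1"
    and collar: "\<eta> > 0" "\<And>s t. \<lbrakk>\<bar>s - a\<bar> < \<eta>; 0 < t; t < \<eta>\<rbrakk> \<Longrightarrow> \<gamma> s + of_real t * \<nu> \<in> \<Omega>"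
  shows "((\<lambda>s. \<phi> (\<gamma> s)) has_vector_derivative \<phi>' (\<gamma> a) * \<tau> a) (at a)"
proof -
  define w where "w s t = \<gamma> s + of_real t * \<nu>" for s t
  have w_lim: "((\<lambda>t. w s t) \<longlongrightarrow> \<gamma> s) (at_right 0)" for s
    unfolding w_def by (auto intro!: tendsto_eq_intros)
  have ev: "eventually (\<lambda>t. 0 < t \<and> t < \<eta>) (at_right (0::real))"
    using collar(1) eventually_at_right_real by auto
  have cl: "\<gamma> s \<in> closure \<Omega>" if "\<bar>s - a\<bar> < \<eta>" for s
  proof (rule Lim_in_closed_set[OF closed_closure _ _ w_lim])
    show "eventually (\<lambda>t. w s t \<in> closure \<Omega>) (at_right 0)"
      using ev by eventually_elim (use collar(2)[OF that] closure_subset in \<open>force simp: w_def\<close>)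
  qed simp
  have \<phi>_lim: "((\<lambda>t. \<phi> (w s t)) \<longlongrightarrow> \<phi> (\<gamma> s)) (at_right 0)" if "\<bar>s - a\<bar> < \<eta>" for s
  proof (rule continuous_on_tendsto_compose[OF cont(1) w_lim cl[OF that]])
    show "eventually (\<lambda>t. w s t \<in> closure \<Omega>) (at_right 0)"
      using ev by eventually_elim (use collar(2)[OF that] closure_subset in \<open>force simp: w_def\<close>)
  qed
  have a: "\<bar>a - a\<bar> < \<eta>" using collar(1) by simp
  have cont\<gamma>: "isCont \<gamma> s" for s
    by (rule has_vector_derivative_continuous[OF \<gamma>(1)])
  \<comment> \<open>Subtracting the expected linear part leaves a function whose increments must be
    bounded by \<open>e * \<bar>s - a\<bar>\<close>; continuity of \<open>\<phi>'\<close> at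
    \<open>\<gamma> a\<close> and unit speed supply the factor \<open>e\<close>.\<close>
  have "((\<lambda>s. \<phi> (\<gamma> s) - \<phi>' (\<gamma> a) * \<gamma> s) has_vector_derivative 0) (at a)"
    unfolding has_vector_derivative_def has_derivative_at_alt
  proof (intro conjI allI impI)
    show "bounded_linear (\<lambda>x. x *\<^sub>R (0 :: complex))" by simp
    fix e :: real assume "e > 0"
    then obtain r where r: "r > 0" "\<And>z. \<lbrakk>z \<in> closure \<Omega>; dist z (\<gamma> a) < r\<rbrakk> \<Longrightarrow> dist (\<phi>' z) (\<phi>' (\<gamma> a)) < e"
      using cont(2) cl[OF a] unfolding continuous_on_iff by blast
    obtain d where d: "d > 0" "\<And>s. \<bar>s - a\<bar> < d \<Longrightarrow> dist (\<gamma> s) (\<gamma> a) < r / 2"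
      using cont\<gamma>[of a] half_gt_zero[OF r(1)] unfolding continuous_at_eps_delta dist_real_def by blast
    have "norm (\<phi> (\<gamma> s) - \<phi>' (\<gamma> a) * \<gamma> s - (\<phi> (\<gamma> a) - \<phi>' (\<gamma> a) * \<gamma> a)) \<le> e * norm (s - a)"
      if s: "\<bar>s - a\<bar> < min d \<eta>" for s
    proof (rule tendsto_upperbound)
      show "((\<lambda>t. norm (\<phi> (w s t) - \<phi>' (\<gamma> a) * \<gamma> s - (\<phi> (w a t) - \<phi>' (\<gamma> a) * \<gamma> a)))
         \<longlongrightarrow> norm (\<phi> (\<gamma> s) - \<phi>' (\<gamma> a) * \<gamma> s - (\<phi> (\<gamma> a) - \<phi>' (\<gamma> a) * \<gamma> a))) (at_right 0)"
        using s a by (intro tendsto_intros \<phi>_lim) auto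
      have "eventually (\<lambda>t. norm (of_real t * \<nu>) < r / 2) (at_right 0)"
        by (rule order_tendstoD(2)[of _ 0]) (use r in \<open>auto intro!: tendsto_eq_intros\<close>)
      with ev show "eventually (\<lambda>t. norm (\<phi> (w s t) - \<phi>' (\<gamma> a) * \<gamma> s - (\<phi> (w a t) - \<phi>' (\<gamma> a) * \<gamma> a))
          \<le> e * norm (s - a)) (at_right 0)"
      proof eventually_elim
        case (elim t)
        have in\<Omega>: "w u t \<in> \<Omega>" if "\<bar>u - a\<bar> < \<eta>" for u
          using collar(2)[OF that] elim by (simp add: w_def)
        have sub: "\<bar>u - a\<bar> < min d \<eta>" if "u \<in> closed_segment a s" for u
          using that s by (auto simp: closed_segment_eq_real_ivl split: if_splits)
        have "norm ((\<phi> (w s t) - \<phi>' (\<gamma> a) * \<gamma> s) - (\<phi> (w a t) - \<phi>' (\<gamma> a) * \<gamma> a)) \<le> e * norm (s - a)"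
        proof (rule differentiable_bound[where S = "closed_segment a s"])
          fix u assume u: "u \<in> closed_segment a s"
          have "((\<lambda>u. w u t) has_vector_derivative \<tau> u) (at u)"
            unfolding w_def by (intro has_vector_derivative_add_const[THEN iffD2] \<gamma>)
          from field_vector_diff_chain_at[OF this \<phi>[OF in\<Omega>]]
          have "((\<lambda>u. \<phi> (w u t)) has_vector_derivative \<tau> u * \<phi>' (w u t)) (at u)"
            using sub[OF u] by (simp add: o_def)
          then have "((\<lambda>u. \<phi> (w u t) - \<phi>' (\<gamma> a) * \<gamma> u) has_vector_derivative
              \<tau> u * \<phi>' (w u t) - \<phi>' (\<gamma> a) * \<tau> u) (at u within closed_segment a s)"
            by (rule has_vector_derivative_diff[OF has_vector_derivative_at_within
                  has_vector_derivative_mult_right[OF has_vector_derivative_at_within[OF \<gamma>(1)]]])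
          then show "((\<lambda>u. \<phi> (w u t) - \<phi>' (\<gamma> a) * \<gamma> u) has_derivative
              (\<lambda>x. x *\<^sub>R (\<tau> u * \<phi>' (w u t) - \<phi>' (\<gamma> a) * \<tau> u))) (at u within closed_segment a s)"
            by (simp add: has_vector_derivative_def)
          have "dist (w u t) (\<gamma> a) \<le> dist (\<gamma> u) (\<gamma> a) + norm (of_real t * \<nu>)"
            unfolding w_def dist_norm using norm_triangle_ineq[of "\<gamma> u - \<gamma> a" "of_real t * \<nu>"]
            by (simp add: algebra_simps)
          also have "\<dots> < r" using d(2)[of u] sub[OF u] elim by simp
          finally have "dist (\<phi>' (w u t)) (\<phi>' (\<gamma> a)) < e"
            using in\<Omega>[of u] sub[OF u] closure_subset by (intro r(2)) auto
          moreover have "\<tau> u * \<phi>' (w u t) - \<phi>' (\<gamma> a) * \<tau> u = \<tau> u * (\<phi>' (w u t) - \<phi>' (\<gamma> a))"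
            by (simp add: algebra_simps)
          ultimately have "norm (\<tau> u * \<phi>' (w u t) - \<phi>' (\<gamma> a) * \<tau> u) \<le> e"
            using \<gamma>(2)[of u] by (simp add: norm_mult dist_norm)
          then show "onorm (\<lambda>x. x *\<^sub>R (\<tau> u * \<phi>' (w u t) - \<phi>' (\<gamma> a) * \<tau> u)) \<le> e"
            using \<open>e > 0\<close> by (intro onorm_bound) (simp_all add: mult_left_mono mult.commute[of e])
        qed auto
        then show ?case .
      qed
    qed simp
    then show "\<exists>d>0. \<forall>y. norm (y - a) < d \<longrightarrow>
       norm (\<phi> (\<gamma> y) - \<phi>' (\<gamma> a) * \<gamma> y - (\<phi> (\<gamma> a) - \<phi>' (\<gamma> a) * \<gamma> a) - (y - a) *\<^sub>R 0) \<le> e * norm (y - a)"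
      using d(1) collar(1) by (intro exI[of _ "min d \<eta>"]) auto
  qed
  from has_vector_derivative_add[OF this has_vector_derivative_mult_right[OF \<gamma>(1), of "\<phi>' (\<gamma> a)" a]]
  show ?thesis by simp
qed

section \<open>Position of the domain relative to its outer curve\<close>

text \<open>\<open>V\<close> is unbounded, connected and disjoint from \<open>S\<close>, hence
  contained in \<open>outside S\<close>. Conversely the connected set \<open>outside S\<close>
  cannot leave \<open>V\<close> without crossing its frontier \<open>S\<close>.\<close>

lemma outside_unique:
  fixes S V :: "complex set"
  assumes "bounded S" "open V" "connected V" "\<not> bounded V" "frontier V = S"
  shows "V = outside S"
proof
  have disj: "V \<inter> S = {}" using assms by (auto simp: frontier_def interior_open)
  show "V \<subseteq> outside S"
  proof
    fix x assume x: "x \<in> V"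
    have "V \<subseteq> connected_component_set (- S) x"
      using x disj assms by (intro connected_component_maximal) auto
    then show "x \<in> outside S"
      using assms(4) disj x bounded_subset by (auto simp: outside_def)
  qed
  show "outside S \<subseteq> V"
  proof (rule ccontr)
    assume "\<not> outside S \<subseteq> V"
    moreover have "V \<noteq> {}" using assms(4) by auto
    ultimately have "outside S \<inter> frontier V \<noteq> {}"
      using \<open>V \<subseteq> outside S\<close> connected_outside[OF assms(1)]
      by (intro connected_Int_frontier) auto
    then show False using assms(5) outside_no_overlap by blast
  qed
qed

text \<open>The unbounded complementary component of the closure is the whole outside of
  \<open>S\<close>. The domain misses it and misses \<open>S\<close>, so only the inside
  remains.\<close>

lemma domain_subset_inside:
  fixes \<Omega> :: "complex set"
  assumes \<Omega>: "open \<Omega>" "connected \<Omega>" "bounded \<Omega>"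
    and S: "frontier (outside (closure \<Omega>)) = S" "S \<subseteq> frontier \<Omega>"
  shows "\<Omega> \<subseteq> inside S"
proof -
  let ?O = "outside (closure \<Omega>)"
  have b: "bounded (closure \<Omega>)" by (rule bounded_closure[OF \<Omega>(3)])
  have "bounded S"
    using S(2) b by (auto simp: frontier_def intro: bounded_subset)
  moreover have "open ?O" by (simp add: open_outside)
  moreover have "connected ?O" using connected_outside[OF b] by simp
  moreover have "\<not> bounded ?O" by (rule unbounded_outside[OF b])
  ultimately have "?O = outside S"
    using S(1) by (intro outside_unique)
  then have "\<Omega> \<inter> outside S = {}"
    using outside_no_overlap[of "closure \<Omega>"] closure_subset[of \<Omega>] by auto
  moreover have "\<Omega> \<inter> S = {}"
    using S(2) \<Omega>(1) by (auto simp: frontier_def interior_open)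
  ultimately show ?thesis
    using inside_Un_outside[of S] by blast
qed

section \<open>Curvature, area and the conclusion\<close>

text \<open>Differentiating \<open>\<tau> * cnj \<tau> = 1\<close> shows that
  \<open>cnj \<tau> * \<tau>'\<close> is purely imaginary, so taking the real part in
  \<open>curvature\<close> loses nothing.\<close>

lemma unit_speed_curvature:
  assumes \<gamma>: "real_analytic_curve \<gamma>" "\<And>s. norm (tangent \<gamma> s) = 1"
  shows "vector_derivative (tangent \<gamma>) (at s) = \<i> * of_real (curvature \<gamma> s) * tangent \<gamma> s"
proof -
  define \<tau> where "\<tau> = tangent \<gamma>"
  define \<tau>' where "\<tau>' = vector_derivative \<tau> (at s)"
  have unit: "\<tau> u * cnj (\<tau> u) = 1" for u
    using \<gamma>(2)[of u] by (simp add: \<tau>_def complex_norm_square[symmetric])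
  have d: "(\<tau> has_vector_derivative \<tau>') (at s)"
    unfolding \<tau>_def \<tau>'_def by (rule real_analytic_curve_smooth[OF \<gamma>(1)])
  have "((\<lambda>u. \<tau> u * cnj (\<tau> u)) has_vector_derivative (\<tau> s * cnj \<tau>' + \<tau>' * cnj (\<tau> s))) (at s)"
    by (intro has_vector_derivative_mult d has_vector_derivative_cnj)
  then have "((\<lambda>u. 1) has_vector_derivative (\<tau> s * cnj \<tau>' + \<tau>' * cnj (\<tau> s))) (at s)"
    by (simp only: unit)
  then have "\<tau> s * cnj \<tau>' + \<tau>' * cnj (\<tau> s) = 0"
    by (rule vector_derivative_unique_at) (rule has_vector_derivative_const)
  then have "Re (cnj (\<tau> s) * \<tau>') = 0"
    by (simp add: complex_eq_iff algebra_simps)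
  then have "- \<i> * cnj (\<tau> s) * \<tau>' = of_real (Re (- \<i> * cnj (\<tau> s) * \<tau>'))"
    by (auto simp: complex_eq_iff)
  then have \<kappa>: "of_real (curvature \<gamma> s) = - \<i> * cnj (\<tau> s) * \<tau>'"
    by (simp add: curvature_def \<tau>_def \<tau>'_def)
  have "\<i> * of_real (curvature \<gamma> s) * \<tau> s = (\<tau> s * cnj (\<tau> s)) * \<tau>'"
    unfolding \<kappa> by (simp add: mult.assoc[symmetric])
  then have "\<i> * of_real (curvature \<gamma> s) * \<tau> s = \<tau>'"
    by (simp only: unit mult_1_left)
  from this[symmetric] show ?thesis
    unfolding \<tau>'_def \<tau>_def .
qed

locale jordan_curve =
  fixes \<gamma> :: "real \<Rightarrow> complex" and L :: real
  assumes jordan: "arclength_analytic_jordan \<gamma> L" and ccw: "counterclockwise \<gamma> L"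
begin

lemma analytic: "real_analytic_curve \<gamma>" and unit_speed: "norm (tangent \<gamma> s) = 1"
  using jordan by (auto simp: arclength_analytic_jordan_def)

sublocale simple_closed_curve \<gamma> "tangent \<gamma>" L
proof
  show "L > 0" "\<gamma> (s + L) = \<gamma> s" "inj_on \<gamma> {0..<L}" for s
    using jordan by (auto simp: arclength_analytic_jordan_def)
  show "(\<gamma> has_vector_derivative tangent \<gamma> s) (at s)" for s
    by (rule real_analytic_curve_smooth[OF analytic])
  show "continuous_on UNIV (tangent \<gamma>)"
    by (intro continuous_at_imp_continuous_on ballI
        has_vector_derivative_continuous[OF real_analytic_curve_smooth(2)[OF analytic]])
  show "tangent \<gamma> s \<noteq> 0" for s
    using unit_speed[of s] by auto
qed

lemma integral_curvature: "(curvature \<gamma> has_integral 2 * pi) {0..L}"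
proof -
  have "((\<lambda>s. vector_derivative (tangent \<gamma>) (at s) / tangent \<gamma> s) has_integral (2 * pi * \<i>)) {0..L}"
  proof (rule turning_number)
    fix w G assume w: "w \<notin> range \<gamma>" and G: "continuous_on UNIV G" "\<And>t. exp (G t) = \<gamma> t - w"
    have range: "range \<gamma> = \<gamma> ` {0..L}"
      using range_eq[of 0] by simp
    consider "w \<in> inside (range \<gamma>)" | "w \<in> outside (range \<gamma>)"
      using w inside_Un_outside[of "range \<gamma>"] by blast
    then show "G L - G 0 = 0 \<or> G L - G 0 = 2 * pi * \<i>"
    proof cases
      case 1
      then have "((\<lambda>s. tangent \<gamma> s / (\<gamma> s - w)) has_integral (2 * pi * \<i>)) {0..L}"
        using ccw unfolding range counterclockwise_def by blast
      then show ?thesis using log_increment_inside[OF _ G] by blast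
    next
      case 2
      then show ?thesis using log_increment_outside[OF _ G] by simp
    qed
  qed (rule real_analytic_curve_smooth[OF analytic])+
  then have "((\<lambda>s. \<i> * of_real (curvature \<gamma> s)) has_integral (2 * pi * \<i>)) {0..L}"
    using deriv_nonzero by (simp add: unit_speed_curvature[OF analytic unit_speed])
  from has_integral_Im[OF this] show ?thesis by simp
qed

end

lemma isoperimetric_domain:
  assumes "jordan_curve \<gamma> L" and \<Omega>: "open \<Omega>" "connected \<Omega>" "bounded \<Omega>" "\<Omega> \<noteq> {}"
    and outer: "frontier (outside (closure \<Omega>)) = \<gamma> ` {0..L}" "\<gamma> ` {0..L} \<subseteq> frontier \<Omega>"
  shows "4 * pi * measure lebesgue \<Omega> \<le> L\<^sup>2" and "measure lebesgue \<Omega> > 0"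
proof -
  interpret jordan_curve \<gamma> L by fact
  have \<Omega>_borel: "\<Omega> \<in> sets borel" using \<Omega>(1) by simp
  have meas: "measure lebesgue \<Omega> = measure lborel \<Omega>"
    using \<Omega>_borel by (simp add: measure_completion)
  have fin: "emeasure lborel \<Omega> < \<infinity>"
    by (rule emeasure_bounded_finite[OF \<Omega>(3)])
  then have em: "emeasure lborel \<Omega> = ennreal (measure lebesgue \<Omega>)"
    unfolding meas by (intro emeasure_eq_ennreal_measure) auto
  show pos: "measure lebesgue \<Omega> > 0"
  proof -
    have "\<not> negligible \<Omega>"
      using open_not_negligible[OF \<Omega>(1,4)] .
    then have "emeasure lborel \<Omega> \<noteq> 0"
      using \<Omega>_borel by (auto simp: negligible_iff_null_sets null_sets_completion_iff null_sets_def)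
    then show ?thesis
      using em by (metis ennreal_0 measure_nonneg order_le_less)
  qed
  have inside: "\<Omega> \<subseteq> inside (\<gamma> ` {0..L})"
    by (rule domain_subset_inside[OF \<Omega>(1-3) outer])
  show "4 * pi * measure lebesgue \<Omega> \<le> L\<^sup>2"
  proof (rule isoperimetric_of_winding[OF \<Omega>_borel em pos L_pos])
    show "\<gamma> s \<noteq> w" if "w \<in> \<Omega>" for w s
      using that inside inside_no_overlap range_eq[of 0] by fastforce
    show "((\<lambda>s. tangent \<gamma> s / (\<gamma> s - w)) has_integral 2 * pi * \<i>) {0..L}" if "w \<in> \<Omega>" for w
      using that inside ccw unfolding counterclockwise_def by blast
  qed (auto simp: continuous cont_deriv unit_speed)
qed

text \<open>Supplies the locality hypothesis of \<open>one_sided_collar\<close>: close to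
  \<open>\<gamma> a\<close>, the boundary consists only of a short arc of the same curve.\<close>

lemma (in simple_closed_curve) locally_frontier:
  assumes frontier: "F = \<gamma> ` {0..L} \<union> K" and K: "closed K" "K \<inter> \<gamma> ` {0..L} = {}" and "\<delta> > 0"
  shows "\<exists>\<rho>>0. F \<inter> ball (\<gamma> a) \<rho> \<subseteq> \<gamma> ` ball a \<delta>"
proof -
  \<comment> \<open>The parameter window of length \<open>L\<close> centred at \<open>a\<close>
    covers the curve and takes the value \<open>\<gamma> a\<close> only at its centre, so
    \<open>C\<close> is a closed set missing \<open>\<gamma> a\<close>.\<close>
  define C where "C = K \<union> \<gamma> ` ({a - L/2..a + L/2} - ball a \<delta>)"
  have range: "\<gamma> ` {0..L} = range \<gamma>" "range \<gamma> = \<gamma> ` {a - L/2..a + L/2}"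
    using range_eq[of 0] range_eq[of "a - L/2"] by (simp_all add: add.commute)
  have "compact ({a - L/2..a + L/2} - ball a \<delta>)"
    by (intro compact_diff) auto
  then have "closed C"
    unfolding C_def by (intro closed_Un K compact_imp_closed compact_continuous_image continuous)
  moreover have "\<gamma> a \<notin> C"
  proof
    assume "\<gamma> a \<in> C"
    then have "\<gamma> a \<in> \<gamma> ` ({a - L/2..a + L/2} - ball a \<delta>)"
      using K(2) unfolding C_def range(1) by blast
    then obtain s where s: "\<gamma> a = \<gamma> s" "s \<in> {a - L/2..a + L/2}" "s \<notin> ball a \<delta>"
      by blast
    then have "a = s"
      using L_pos by (intro eq_imp_eq) (auto simp: abs_if field_simps)
    then show False using s \<open>\<delta> > 0\<close> by simp
  qed
  ultimately have "\<exists>\<rho>>0. ball (\<gamma> a) \<rho> \<subseteq> - C"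
    using open_contains_ball[of "- C"] by (simp add: open_closed)
  then obtain \<rho> where \<rho>: "\<rho> > 0" "ball (\<gamma> a) \<rho> \<subseteq> - C"
    by blast
  moreover have "F - C \<subseteq> \<gamma> ` ball a \<delta>"
    unfolding frontier C_def range by blast
  ultimately show ?thesis by blast
qed

theorem theorem3p1:
  fixes \<Omega> :: "complex set" and n :: nat
    and \<gamma> :: "nat \<Rightarrow> real \<Rightarrow> complex" and L :: "nat \<Rightarrow> real"
    and \<phi> \<phi>' :: "complex \<Rightarrow> complex"
  assumes n2: "n \<ge> 2"
    and dom: "open \<Omega>" "connected \<Omega>" "bounded \<Omega>"
    and curves: "\<forall>k\<in>{1..n}. arclength_analytic_jordan (\<gamma> k) (L k) \<and> counterclockwise (\<gamma> k) (L k)"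
    and disj: "\<forall>j\<in>{1..n}. \<forall>k\<in>{1..n}. j \<noteq> k \<longrightarrow> \<gamma> j ` {0..L j} \<inter> \<gamma> k ` {0..L k} = {}"
    and bdry: "frontier \<Omega> = (\<Union>k\<in>{1..n}. \<gamma> k ` {0..L k})"
    and outer: "frontier (outside (closure \<Omega>)) = \<gamma> 1 ` {0..L 1}"
    and hol: "\<phi> holomorphic_on \<Omega>" "continuous_on (closure \<Omega>) \<phi>"
    and deriv: "\<forall>z\<in>\<Omega>. (\<phi> has_field_derivative \<phi>' z) (at z)" "continuous_on (closure \<Omega>) \<phi>'"
    and E: "\<forall>k\<in>{1..n}. \<forall>s.
              cnj (\<gamma> k s) + \<i> * of_real (alpha k) *
                of_real (2 * measure lebesgue \<Omega> / (\<Sum>j\<in>{1..n}. L j)) * cnj (tangent (\<gamma> k) s)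
              = \<phi> (\<gamma> k s)"
  shows "(\<forall>k\<in>{1..n}. \<forall>s.
            \<phi>' (\<gamma> k s) * (tangent (\<gamma> k) s)\<^sup>2
            = of_real (1 + alpha k * (2 * measure lebesgue \<Omega> / (\<Sum>j\<in>{1..n}. L j)) * curvature (\<gamma> k) s))
       \<and> (\<forall>k\<in>{1..n}.
            integral {0..L k} (\<lambda>s. 1 + alpha k * (2 * measure lebesgue \<Omega> / (\<Sum>j\<in>{1..n}. L j)) * curvature (\<gamma> k) s) > 0)"
proof -
  define A where "A = measure lebesgue \<Omega>"
  define P where "P = (\<Sum>j\<in>{1..n}. L j)"
  define \<mu> where "\<mu> = 2 * A / P"
  have jc: "jordan_curve (\<gamma> k) (L k)" if "k \<in> {1..n}" for k
    using curves that by unfold_locales auto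
  have len_pos: "L k > 0" if "k \<in> {1..n}" for k
    using curves that by (auto simp: arclength_analytic_jordan_def)
  have one: "1 \<in> {1..n}" and two: "2 \<in> {1..n}"
    using n2 by auto
  have "\<gamma> 1 ` {0..L 1} \<subseteq> frontier \<Omega>"
    using one unfolding bdry by blast
  moreover have "\<gamma> 1 ` {0..L 1} \<noteq> {}"
    using len_pos[OF one] by simp
  ultimately have "\<Omega> \<noteq> {}" by auto
  have A: "4 * pi * A \<le> (L 1)\<^sup>2" "A > 0"
    unfolding A_def
    by (rule isoperimetric_domain[OF jc[OF one] dom \<open>\<Omega> \<noteq> {}\<close> outer \<open>\<gamma> 1 ` {0..L 1} \<subseteq> frontier \<Omega>\<close>])+
  \<comment> \<open>A second boundary curve makes \<open>P\<close> strictly larger than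
    \<open>L 1\<close>; this gives strict positivity even when the isoperimetric bound is an
    equality.\<close>
  have "(\<Sum>j\<in>{1, 2}. L j) \<le> P"
    unfolding P_def using len_pos one two by (intro sum_mono2) (auto intro: less_imp_le)
  then have P: "P > L 1" "P > 0"
    using len_pos[OF one] len_pos[OF two] by auto
  have \<mu>: "\<mu> > 0" using A P by (simp add: \<mu>_def)
  have formula: "\<phi>' (\<gamma> k s) * (tangent (\<gamma> k) s)\<^sup>2 = of_real (1 + alpha k * \<mu> * curvature (\<gamma> k) s)"
    if k: "k \<in> {1..n}" for k s
  proof -
    interpret jordan_curve "\<gamma> k" "L k" by (rule jc[OF k])
    let ?\<tau> = "tangent (\<gamma> k)"
    let ?K = "\<Union>j\<in>{1..n} - {k}. \<gamma> j ` {0..L j}"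
    have fr: "frontier \<Omega> = \<gamma> k ` {0..L k} \<union> ?K"
      unfolding bdry using k by blast
    have "closed ?K"
    proof (intro closed_UN ballI)
      fix j assume "j \<in> {1..n} - {k}"
      then interpret j: jordan_curve "\<gamma> j" "L j" by (intro jc) auto
      show "closed (\<gamma> j ` {0..L j})"
        by (intro compact_imp_closed compact_continuous_image j.continuous) auto
    qed simp
    moreover have "?K \<inter> \<gamma> k ` {0..L k} = {}"
      using disj k by blast
    ultimately have loc: "\<exists>\<rho>>0. frontier \<Omega> \<inter> ball (\<gamma> k s) \<rho> \<subseteq> \<gamma> k ` ball s \<delta>" if "\<delta> > 0" for \<delta>
      using that by (intro locally_frontier[OF fr])
    have on_fr: "\<gamma> k u \<in> frontier \<Omega>" for u
      using fr range_eq[of 0] by auto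
    obtain \<eta> \<nu> where collar: "\<eta> > 0" "\<And>u t. \<lbrakk>\<bar>u - s\<bar> < \<eta>; 0 < t; t < \<eta>\<rbrakk> \<Longrightarrow> \<gamma> k u + of_real t * \<nu> \<in> \<Omega>"
      using one_sided_collar[OF dom(1) deriv cont_deriv deriv_nonzero on_fr loc] by blast
    \<comment> \<open>\<open>assms(11)\<close> and \<open>assms(12)\<close> are the derivative of
      \<open>\<phi>\<close> in the domain and the continuity of \<open>\<phi>'\<close> on its
      closure.\<close>
    have 1: "((\<lambda>s. \<phi> (\<gamma> k s)) has_vector_derivative \<phi>' (\<gamma> k s) * ?\<tau> s) (at s)"
      by (rule boundary_chain_rule[OF _ hol(2) assms(12) deriv unit_speed collar]) (use assms(11) in auto)
    have "((\<lambda>s. cnj (\<gamma> k s) + \<i> * of_real (alpha k) * of_real \<mu> * cnj (?\<tau> s)) has_vector_derivative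
        cnj (?\<tau> s) + \<i> * of_real (alpha k) * of_real \<mu> * cnj (vector_derivative ?\<tau> (at s))) (at s)"
      by (intro has_vector_derivative_add has_vector_derivative_mult_right has_vector_derivative_cnj
          deriv real_analytic_curve_smooth(2)[OF analytic])
    moreover have "cnj (\<gamma> k s) + \<i> * of_real (alpha k) * of_real \<mu> * cnj (?\<tau> s) = \<phi> (\<gamma> k s)" for s
      using E k unfolding \<mu>_def A_def P_def by blast
    ultimately have "\<phi>' (\<gamma> k s) * ?\<tau> s
        = cnj (?\<tau> s) + \<i> * of_real (alpha k) * of_real \<mu> * cnj (vector_derivative ?\<tau> (at s))"
      using 1 by (simp only:) (rule vector_derivative_unique_at)
    \<comment> \<open>Conjugating \<open>\<tau>' = \<i> * \<kappa> * \<tau>\<close> produces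
      \<open>- \<i>\<close>, which cancels the factor \<open>\<i>\<close> of (E). Multiplication by
      \<open>\<tau>\<close> then removes the remaining conjugate.\<close>
    also have "\<dots> = of_real (1 + alpha k * \<mu> * curvature (\<gamma> k) s) * cnj (?\<tau> s)"
      unfolding unit_speed_curvature[OF analytic unit_speed] by (simp add: algebra_simps)
    finally have "\<phi>' (\<gamma> k s) * (?\<tau> s)\<^sup>2
        = of_real (1 + alpha k * \<mu> * curvature (\<gamma> k) s) * (?\<tau> s * cnj (?\<tau> s))"
      by (simp add: power2_eq_square algebra_simps)
    also have "?\<tau> s * cnj (?\<tau> s) = 1"
      using unit_speed[of s] by (simp add: complex_norm_square[symmetric])
    finally show ?thesis by simp
  qed
  have "integral {0..L k} (\<lambda>s. 1 + alpha k * \<mu> * curvature (\<gamma> k) s) > 0" if k: "k \<in> {1..n}" for k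
  proof -
    interpret jordan_curve "\<gamma> k" "L k" by (rule jc[OF k])
    have "((\<lambda>s. 1 + alpha k * \<mu> * curvature (\<gamma> k) s) has_integral
        (L k - 0) *\<^sub>R 1 + alpha k * \<mu> * (2 * pi)) {0..L k}"
      using has_integral_const_real[of "1::real" 0 "L k"] len_pos[OF k]
      by (intro has_integral_add has_integral_mult_right integral_curvature) auto
    then have "integral {0..L k} (\<lambda>s. 1 + alpha k * \<mu> * curvature (\<gamma> k) s) = L k + alpha k * \<mu> * (2 * pi)"
      by (simp add: integral_unique)
    moreover have "L k + alpha k * \<mu> * (2 * pi) > 0"
    proof (cases "k = 1")
      case True
      \<comment> \<open>Dividing by \<open>P\<close> turns the left side into
        \<open>\<mu> * (2 * pi)\<close>, because \<open>\<mu> = 2 * A / P\<close>.\<close>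
      have "4 * pi * A < L 1 * P"
        using A(1) P len_pos[OF one] by (smt (verit) mult_strict_left_mono power2_eq_square)
      then have "\<mu> * (2 * pi) < L 1"
        using P by (simp add: \<mu>_def pos_divide_less_eq mult_ac)
      then show ?thesis using True by (simp add: alpha_def)
    next
      case False
      then show ?thesis using \<mu> len_pos[OF k] by (simp add: alpha_def add_pos_pos)
    qed
    ultimately show ?thesis by simp
  qed
  with formula show ?thesis
    unfolding \<mu>_def A_def P_def by blast
qed

end
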